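(* Let $(\tilde{\mathcal{C}},\tilde\lambda)$ be a $(2n+3)$-dimensional contact manifold with canonical coordinates $(x,x^{n+1},p,p_{n+1},z)$, $\tilde\lambda=dz-p_a\,dx^a-p_{n+1}\,dx^{n+1}$. Let $\psi$ be a function of $x=\{x^1,\dots,x^n\}$, $p_{n+1}^{(0)}$ a non-zero constant, $F^1,\dots,F^n$ functions of $x$ that do not identically vanish, and $\tilde\gamma_0$ a non-zero constant. Let $\tilde X$ be the contact Hamiltonian vector field associated to $$\tilde h=\Big(\frac{p_{n+1}}{p_{n+1}^{(0)}}\frac{\partial\psi}{\partial x^a}(x)-p_a\Big)F^a(x)+\tilde\gamma_0\big(\psi(x)+p_{n+1}^{(0)}x^{n+1}-z\big),$$ considered on the region $\tilde h>0$. Then, within the class of densities depending on the coordinates only through $\tilde h$, an invariant measure for $\tilde X$ is $$\tilde\Omega^{\mathrm{Inv}}=\tilde f^{\mathrm{Inv}}\,\tilde\Omega_{\tilde\lambda},\qquad \tilde f^{\mathrm{Inv}}=\frac{1}{\tilde Z}\,\tilde h^{-(n+2)},$$ where $\tilde Z$ is a non-zero constant.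
   Context: All objects are smooth; the repeated index $a$ is summed over $1,\dots,n$. The standard volume form is $\tilde\Omega_{\tilde\lambda}=\tilde\lambda\wedge\underbrace{d\tilde\lambda\wedge\dots\wedge d\tilde\lambda}_{n+1}$. An invariant measure for a vector field $X$ is a non-vanishing top-degree form $\Omega$ with $\partial\Omega/\partial t=0$ (no explicit time dependence) and $\mathcal{L}_X\Omega=0$. The contact Hamiltonian vector field of a function $\tilde h$ on $\tilde{\mathcal{C}}$ is defined by $\iota_{\tilde X}\tilde\lambda=\tilde h$, $\iota_{\tilde X}d\tilde\lambda=-(d\tilde h-(\partial\tilde h/\partial z)\tilde\lambda)$; in coordinates, for $\mu=1,\dots,n+1$, $\dot x^\mu=-\partial\tilde h/\partial p_\mu$, $\dot p_\mu=\partial\tilde h/\partial x^\mu+p_\mu\,\partial\tilde h/\partial z$, $\dot z=\tilde h-\sum_{\mu=1}^{n+1}p_\mu\,\partial\tilde h/\partial p_\mu$. *)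

theory Defs
  imports "HOL-Analysis.Analysis"
begin

section \<open>Smooth functions\<close>

primrec Ck_on :: "nat \<Rightarrow> 'a::euclidean_space set \<Rightarrow> ('a \<Rightarrow> real) \<Rightarrow> bool" where
  "Ck_on 0 S f \<longleftrightarrow> continuous_on S f"
| "Ck_on (Suc k) S f \<longleftrightarrow>
     (\<forall>x\<in>S. f differentiable (at x)) \<and>
     (\<forall>v. Ck_on k S (\<lambda>x. frechet_derivative f (at x) v))"

text \<open>Meant for open \<open>S\<close> only: the derivatives are two-sided.\<close>

definition smooth_on :: "'a::euclidean_space set \<Rightarrow> ('a \<Rightarrow> real) \<Rightarrow> bool" where
  "smooth_on S f \<longleftrightarrow> (\<forall>k. Ck_on k S f)"

section \<open>Differential forms on open subsets of a Euclidean space\<close>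

text \<open>
  A form takes a point and the list of its vector arguments. A \<open>k\<close>-form vanishes on every list
  whose length differs from \<open>k\<close>, so that the degree need not be passed to the operations below.
\<close>

type_synonym 'a dform = "'a \<Rightarrow> 'a list \<Rightarrow> real"

definition differential_form :: "nat \<Rightarrow> 'a::euclidean_space set \<Rightarrow> 'a dform \<Rightarrow> bool" where
  "differential_form k S \<omega> \<longleftrightarrow>
     (\<forall>q\<in>S. \<forall>vs. length vs \<noteq> k \<longrightarrow> \<omega> q vs = 0) \<and>
     (\<forall>q\<in>S. \<forall>vs i. length vs = k \<and> i < k \<longrightarrow> linear (\<lambda>u. \<omega> q (vs[i := u]))) \<and>
     (\<forall>q\<in>S. \<forall>vs i j. length vs = k \<and> i < j \<and> j < k \<and> vs ! i = vs ! j \<longrightarrow> \<omega> q vs = 0) \<and>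
     (\<forall>vs. smooth_on S (\<lambda>q. \<omega> q vs))"

definition zero_form :: "('a \<Rightarrow> real) \<Rightarrow> 'a dform" where
  "zero_form f = (\<lambda>q vs. if vs = [] then f q else 0)"

text \<open>
  For a \<open>k\<close>-form \<open>\<alpha>\<close> and an \<open>l\<close>-form \<open>\<beta>\<close> only one summand survives, namely
  \<open>1 / (k! l!)\<close> times the alternating sum over all permutations of the \<open>k + l\<close> arguments; thus
  \<open>(\<alpha> \<and> \<beta>)(u, v) = \<alpha>(u) \<beta>(v) - \<alpha>(v) \<beta>(u)\<close> for one-forms.
\<close>

definition wedge :: "'a dform \<Rightarrow> 'a dform \<Rightarrow> 'a dform" (infixl "\<and>\<^sub>F" 70) where
  "(\<alpha> \<and>\<^sub>F \<beta>) = (\<lambda>q vs. let m = length vs in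
     \<Sum>k\<le>m. (\<Sum>\<sigma> | \<sigma> permutes {..<m}. of_int (sign \<sigma>)
                 * \<alpha> q (map (\<lambda>i. vs ! \<sigma> i) [0..<k])
                 * \<beta> q (map (\<lambda>i. vs ! \<sigma> i) [k..<m]))
              / (fact k * fact (m - k)))"

text \<open>
  The invariant formula for \<open>d\<omega>(v\<^sub>0, \<dots>, v\<^sub>k)\<close>, with the vectors extended to constant vector
  fields, whose Lie brackets vanish.
\<close>

definition ext_d :: "'a::euclidean_space dform \<Rightarrow> 'a dform" where
  "ext_d \<omega> = (\<lambda>q vs. \<Sum>i<length vs.
     (- 1) ^ i * frechet_derivative (\<lambda>y. \<omega> y (take i vs @ drop (Suc i) vs)) (at q) (vs ! i))"

definition iprod :: "('a \<Rightarrow> 'a) \<Rightarrow> 'a dform \<Rightarrow> 'a dform" where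
  "iprod X \<omega> = (\<lambda>q vs. \<omega> q (X q # vs))"

definition lie_derivative :: "('a::euclidean_space \<Rightarrow> 'a) \<Rightarrow> 'a dform \<Rightarrow> 'a dform" where
  "lie_derivative X \<omega> = (\<lambda>q vs. iprod X (ext_d \<omega>) q vs + ext_d (iprod X \<omega>) q vs)"

text \<open>
  Invariant measures are a priori allowed to depend on time; the first argument of \<open>\<Omega>\<close> is the time.
\<close>

definition invariant_measure ::
    "'a::euclidean_space set \<Rightarrow> ('a \<Rightarrow> 'a) \<Rightarrow> (real \<Rightarrow> 'a dform) \<Rightarrow> bool" where
  "invariant_measure S X \<Omega> \<longleftrightarrow>
     (\<forall>t. differential_form DIM('a) S (\<Omega> t)) \<and>
     (\<forall>t. \<forall>q\<in>S. \<exists>vs. \<Omega> t q vs \<noteq> 0) \<and>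
     (\<forall>t. \<forall>q\<in>S. \<forall>vs. ((\<lambda>s. \<Omega> s q vs) has_real_derivative 0) (at t)) \<and>
     (\<forall>t. \<forall>q\<in>S. \<forall>vs. lie_derivative X (\<Omega> t) q vs = 0)"

section \<open>Contact geometry in canonical coordinates\<close>

text \<open>
  A point is \<open>(x, y, p, w, z)\<close> with \<open>y = x\<^sup>n\<^sup>+\<^sup>1\<close>, \<open>w = p\<^sub>n\<^sub>+\<^sub>1\<close> and \<open>n = CARD('n)\<close>.
\<close>

type_synonym 'n phase = "(real^'n) \<times> real \<times> (real^'n) \<times> real \<times> real"

definition contact_form :: "('n::finite) phase dform" where
  "contact_form = (\<lambda>(x, y, p, w, z) vs.
     case vs of [(dx, dy, dp, dw, dz)] \<Rightarrow> dz - (\<Sum>a\<in>UNIV. p $ a * dx $ a) - w * dy | _ \<Rightarrow> 0)"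

definition standard_volume :: "('n::finite) phase dform" where
  "standard_volume =
     ((\<lambda>\<omega>. \<omega> \<and>\<^sub>F ext_d contact_form) ^^ (CARD('n) + 1)) contact_form"

definition partial_z :: "(('n::finite) phase \<Rightarrow> real) \<Rightarrow> 'n phase \<Rightarrow> real" where
  "partial_z h q = frechet_derivative h (at q) (0, 0, 0, 0, 1)"

definition contact_hamiltonian_vf ::
    "('n::finite) phase set \<Rightarrow> ('n phase \<Rightarrow> real) \<Rightarrow> ('n phase \<Rightarrow> 'n phase) \<Rightarrow> bool" where
  "contact_hamiltonian_vf S h X \<longleftrightarrow>
     (\<forall>q\<in>S. \<forall>vs. iprod X contact_form q vs = zero_form h q vs) \<and>
     (\<forall>q\<in>S. \<forall>vs. iprod X (ext_d contact_form) q vs =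
        - (ext_d (zero_form h) q vs - partial_z h q * contact_form q vs))"

definition contact_hamiltonian ::
    "(real^'n \<Rightarrow> real) \<Rightarrow> ('n \<Rightarrow> real^'n \<Rightarrow> real) \<Rightarrow> real \<Rightarrow> real \<Rightarrow> ('n::finite) phase \<Rightarrow> real" where
  "contact_hamiltonian \<psi> F p0 \<gamma>0 = (\<lambda>(x, y, p, w, z).
     (\<Sum>a\<in>UNIV. (w / p0 * frechet_derivative \<psi> (at x) (axis a 1) - p $ a) * F a x)
     + \<gamma>0 * (\<psi> x + p0 * y - z))"

end

theory Submission
  imports Defs
begin

text \<open>
  The standard volume form has constant coefficients in canonical coordinates and is nowhere zero, so
  the Lie derivative along \<open>X\<close> of its multiple by a density \<open>f\<close> is its multiple by \<open>X f + f div X\<close>.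
  The Hamiltonian is affine in \<open>p\<close>, \<open>p\<^sub>n\<^sub>+\<^sub>1\<close> and \<open>z\<close>; its contact vector field therefore has the
  explicit constant divergence \<open>- (n + 2) \<gamma>\<^sub>0\<close>, and \<open>X h = - \<gamma>\<^sub>0 h\<close>. For \<open>f = G (h)\<close> invariance thus
  reads \<open>G' h + (n + 2) G = 0\<close>, that is, \<open>G h\<^sup>n\<^sup>+\<^sup>2\<close> has zero derivative. On a component \<open>K\<close> of the
  domain the positive values of \<open>h\<close> form an interval, even though \<open>K \<inter> {h > 0}\<close> may be disconnected,
  so \<open>G h\<^sup>n\<^sup>+\<^sup>2\<close> is a single constant there.
\<close>

section \<open>Smooth functions\<close>

text \<open>The divergence is constant because the traces of the x-block and of the p-block cancel:
  the momenta are transported by minus the transposed Jacobian of F. What survives is the term from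
  dh/dz in each of the n + 1 momentum equations and the damping of z, hence the number n + 2. The
  wedge power is an iterated alternating sum over permutations, so the coefficient of the volume
  form is not visible in it. It need not be computed: on a Darboux basis all nonzero terms are
  positive, which excludes cancellation. Alternating forms of top degree span a line, so both the
  invariance of the volume under a shear and the trace formula behind the Lie derivative can be
  checked on a single basis. For uniqueness, the density is only known to factor through h; the
  regularity of the factor G has to be recovered from that of the density. The domain may be
  disconnected, so each component has its own constant.\<close>

lemma Ck_on_differentiable: "Ck_on (Suc k) S f \<Longrightarrow> x \<in> S \<Longrightarrow> f differentiable (at x)"
  by simp

lemma smooth_on_differentiable: "smooth_on S f \<Longrightarrow> x \<in> S \<Longrightarrow> f differentiable (at x)"
  using Ck_on_differentiable[of 0 S f x] unfolding smooth_on_def by blast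

lemma smooth_on_frechet_derivative:
  "smooth_on S f \<Longrightarrow> smooth_on S (\<lambda>x. frechet_derivative f (at x) v)"
  unfolding smooth_on_def by (metis Ck_on.simps(2))

lemma frechet_derivative_cong_open:
  assumes "open S" "x \<in> S" "\<And>y. y \<in> S \<Longrightarrow> f y = g y"
  shows "frechet_derivative f (at x) = frechet_derivative g (at x)"
proof -
  \<comment> \<open>\<open>frechet_derivative\<close> is a choice among the derivatives, so it is
    enough that both functions have the same candidates; this also covers points without a
    derivative.\<close>
  have "(f has_derivative D) (at x) \<longleftrightarrow> (g has_derivative D) (at x)" for D
    using has_derivative_transform_within_open[OF _ assms(1,2), of f D UNIV g]
      has_derivative_transform_within_open[OF _ assms(1,2), of g D UNIV f] assms(3) by auto
  then show ?thesis
    by (simp add: frechet_derivative_def)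
qed

lemma differentiable_cong_open:
  assumes "open S" "x \<in> S" "\<And>y. y \<in> S \<Longrightarrow> f y = g y" "f differentiable (at x)"
  shows "g differentiable (at x)"
  using assms has_derivative_transform_within_open[OF _ assms(1,2), of f _ UNIV g]
  unfolding differentiable_def by blast

text \<open>The rules for sums, products and inverses give the derivative only at points of S; this
  lemma replaces the derivative by such an expression inside the recursion of
  \<open>Ck_on\<close>.\<close>

lemma Ck_on_cong:
  assumes "open S"
  shows "(\<And>y. y \<in> S \<Longrightarrow> f y = g y) \<Longrightarrow> Ck_on k S f \<Longrightarrow> Ck_on k S g"
proof (induction k arbitrary: f g)
  case 0
  then show ?case by (simp cong: continuous_on_cong)
next
  case (Suc k)
  have "Ck_on k S (\<lambda>x. frechet_derivative g (at x) v)" for v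
  proof (rule Suc.IH)
    show "frechet_derivative f (at y) v = frechet_derivative g (at y) v" if "y \<in> S" for y
      using frechet_derivative_cong_open[OF assms that, of f g] Suc.prems(1) by simp
  qed (use Suc.prems(2) in simp)
  moreover have "g differentiable at x" if "x \<in> S" for x
    using differentiable_cong_open[OF assms that, of f g] Suc.prems that by simp
  ultimately show ?case by simp
qed

lemma Ck_on_Suc_imp: "Ck_on (Suc k) S f \<Longrightarrow> Ck_on k S f"
proof (induction k arbitrary: f)
  case 0
  then show ?case
    by (auto intro!: continuous_at_imp_continuous_on differentiable_imp_continuous_within)
next
  case (Suc k)
  then show ?case by (metis Ck_on.simps(2))
qed

lemma Ck_on_subset: "T \<subseteq> S \<Longrightarrow> Ck_on k S f \<Longrightarrow> Ck_on k T f"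
  by (induction k arbitrary: f) (auto intro: continuous_on_subset)

lemma smooth_on_subset: "T \<subseteq> S \<Longrightarrow> smooth_on S f \<Longrightarrow> smooth_on T f"
  unfolding smooth_on_def using Ck_on_subset by blast

lemma Ck_on_const: "Ck_on k S (\<lambda>x. c)"
  by (induction k arbitrary: c) auto

lemma frechet_derivative_add_real:
  fixes f g :: "'a::real_normed_vector \<Rightarrow> real"
  assumes "f differentiable (at x)" "g differentiable (at x)"
  shows "frechet_derivative (\<lambda>x. f x + g x) (at x) v
    = frechet_derivative f (at x) v + frechet_derivative g (at x) v"
proof -
  have "((\<lambda>x. f x + g x) has_derivative
      (\<lambda>h. frechet_derivative f (at x) h + frechet_derivative g (at x) h)) (at x)"
    using assms frechet_derivative_works has_derivative_add by blast
  from frechet_derivative_at[OF this, symmetric] show ?thesis by simp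
qed

lemma Ck_on_add:
  assumes "open S"
  shows "Ck_on k S f \<Longrightarrow> Ck_on k S g \<Longrightarrow> Ck_on k S (\<lambda>x. f x + g x)"
proof (induction k arbitrary: f g)
  case 0
  then show ?case by (auto intro: continuous_intros)
next
  case (Suc k)
  have "Ck_on k S (\<lambda>x. frechet_derivative (\<lambda>x. f x + g x) (at x) v)" for v
    by (rule Ck_on_cong[OF assms, of "\<lambda>x. frechet_derivative f (at x) v + frechet_derivative g (at x) v"])
      (use Suc in \<open>auto simp: frechet_derivative_add_real\<close>)
  with Suc.prems show ?case by auto
qed

lemma frechet_derivative_mult_real:
  fixes f g :: "'a::real_normed_vector \<Rightarrow> real"
  assumes "f differentiable (at x)" "g differentiable (at x)"
  shows "frechet_derivative (\<lambda>x. f x * g x) (at x) v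
    = f x * frechet_derivative g (at x) v + frechet_derivative f (at x) v * g x"
proof -
  have "((\<lambda>x. f x * g x) has_derivative
      (\<lambda>h. f x * frechet_derivative g (at x) h + frechet_derivative f (at x) h * g x)) (at x)"
    using assms frechet_derivative_works has_derivative_mult by blast
  from frechet_derivative_at[OF this, symmetric] show ?thesis by simp
qed

lemma Ck_on_mult:
  assumes "open S"
  shows "Ck_on k S f \<Longrightarrow> Ck_on k S g \<Longrightarrow> Ck_on k S (\<lambda>x. f x * g x)"
proof (induction k arbitrary: f g)
  case 0
  then show ?case by (auto intro: continuous_intros)
next
  case (Suc k)
  have "Ck_on k S (\<lambda>x. frechet_derivative (\<lambda>x. f x * g x) (at x) v)" for v
  proof (rule Ck_on_cong[OF assms])
    show "Ck_on k S (\<lambda>x. f x * frechet_derivative g (at x) v + frechet_derivative f (at x) v * g x)"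
      using Suc.prems Ck_on_Suc_imp[OF Suc.prems(1)] Ck_on_Suc_imp[OF Suc.prems(2)]
      by (intro Ck_on_add[OF assms] Suc.IH) simp_all
  qed (use Suc.prems in \<open>simp add: frechet_derivative_mult_real\<close>)
  with Suc.prems show ?case by auto
qed

lemma frechet_derivative_inverse_real:
  fixes f :: "'a::real_normed_vector \<Rightarrow> real"
  assumes "f differentiable (at x)" "f x \<noteq> 0"
  shows "frechet_derivative (\<lambda>x. inverse (f x)) (at x) v
    = - 1 * (inverse (f x) * (frechet_derivative f (at x) v * inverse (f x)))"
proof -
  have "((\<lambda>x. inverse (f x)) has_derivative
      (\<lambda>h. - (inverse (f x) * frechet_derivative f (at x) h * inverse (f x)))) (at x)"
    by (rule Deriv.has_derivative_inverse[OF assms(2) iffD1[OF frechet_derivative_works assms(1)]])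
  from frechet_derivative_at[OF this, symmetric] show ?thesis by simp
qed

text \<open>The derivative of the inverse is a polynomial in the inverse itself and in the
  derivative of f, so induction on the order closes without a general chain rule.\<close>

lemma Ck_on_inverse:
  assumes "open S" "\<And>x. x \<in> S \<Longrightarrow> f x \<noteq> 0"
  shows "Ck_on k S f \<Longrightarrow> Ck_on k S (\<lambda>x. inverse (f x))"
proof (induction k)
  case 0
  with assms show ?case by (simp add: continuous_on_inverse)
next
  case (Suc k)
  have "Ck_on k S (\<lambda>x. frechet_derivative (\<lambda>x. inverse (f x)) (at x) v)" for v
  proof (rule Ck_on_cong[OF assms(1)])
    show "Ck_on k S (\<lambda>x. - 1 * (inverse (f x) * (frechet_derivative f (at x) v * inverse (f x))))"
      by (intro Ck_on_mult[OF assms(1)] Ck_on_const Suc.IH[OF Ck_on_Suc_imp[OF Suc.prems]])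
        (use Suc.prems in simp)
  qed (use Suc.prems assms in \<open>simp add: frechet_derivative_inverse_real\<close>)
  moreover have "(\<lambda>x. inverse (f x)) differentiable at x" if "x \<in> S" for x
    using Suc.prems assms(2) that by (simp add: differentiable_inverse)
  ultimately show ?case by simp
qed

lemma Ck_on_bounded_linear:
  assumes "bounded_linear f"
  shows "Ck_on k S f"
proof (cases k)
  case 0
  then show ?thesis
    using assms by (simp add: linear_continuous_on)
next
  case (Suc l)
  have "(f has_derivative f) (at x)" for x
    using assms bounded_linear_imp_has_derivative by blast
  from frechet_derivative_at[OF this] differentiableI[OF this]
  have "frechet_derivative f (at x) = f" "f differentiable (at x)" for x
    by simp_all
  then show ?thesis
    by (simp add: Suc Ck_on_const)
qed

lemma has_derivative_comp_fst:
  fixes f :: "'a::real_normed_vector \<Rightarrow> 'c::real_normed_vector"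
    and q :: "'a \<times> ('b::real_normed_vector)"
  assumes "f differentiable (at (fst q))"
  shows "((\<lambda>q. f (fst q)) has_derivative (\<lambda>v. frechet_derivative f (at (fst q)) (fst v))) (at q)"
proof -
  have "(fst has_derivative fst) (at q)"
    by (rule bounded_linear_imp_has_derivative[OF bounded_linear_fst])
  moreover have "(f has_derivative frechet_derivative f (at (fst q))) (at (fst q))"
    by (rule iffD1[OF frechet_derivative_works assms])
  ultimately show ?thesis
    by (rule has_derivative_compose[where f = fst])
qed

text \<open>The only composition that is needed, because \<psi> and F depend on x alone. The
  direction v enters the derivative through its first component, which stays constant in the
  induction.\<close>

lemma Ck_on_comp_fst:
  fixes f :: "'a::euclidean_space \<Rightarrow> real" and S :: "('a \<times> 'b::euclidean_space) set"
  assumes "open S"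
  shows "Ck_on k (fst ` S) f \<Longrightarrow> Ck_on k S (\<lambda>q. f (fst q))"
proof (induction k arbitrary: f)
  case 0
  then show ?case
    using continuous_on_compose2[of "fst ` S" f S fst] by (simp add: continuous_on_fst)
next
  case (Suc k)
  have *: "((\<lambda>q. f (fst q)) has_derivative (\<lambda>v. frechet_derivative f (at (fst q)) (fst v))) (at q)"
    if "q \<in> S" for q
    using has_derivative_comp_fst[of f q] Suc.prems that by simp
  have "Ck_on k S (\<lambda>q. frechet_derivative (\<lambda>q. f (fst q)) (at q) v)" for v
  proof (rule Ck_on_cong[OF assms])
    show "Ck_on k S (\<lambda>q. frechet_derivative f (at (fst q)) (fst v))"
      using Suc.IH[of "\<lambda>x. frechet_derivative f (at x) (fst v)"] Suc.prems by simp
  qed (simp add: frechet_derivative_at[OF *, symmetric])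
  moreover have "(\<lambda>q. f (fst q)) differentiable at q" if "q \<in> S" for q
    using *[OF that] by (auto simp: differentiable_def)
  ultimately show ?case by simp
qed

context
  fixes S :: "'a::euclidean_space set"
  assumes op: "open S"
begin

lemma smooth_on_const: "smooth_on S (\<lambda>x. c)"
  by (simp add: smooth_on_def Ck_on_const)

lemma smooth_on_add: "smooth_on S f \<Longrightarrow> smooth_on S g \<Longrightarrow> smooth_on S (\<lambda>x. f x + g x)"
  by (simp add: smooth_on_def Ck_on_add[OF op])

lemma smooth_on_mult: "smooth_on S f \<Longrightarrow> smooth_on S g \<Longrightarrow> smooth_on S (\<lambda>x. f x * g x)"
  by (simp add: smooth_on_def Ck_on_mult[OF op])

lemma smooth_on_diff: "smooth_on S f \<Longrightarrow> smooth_on S g \<Longrightarrow> smooth_on S (\<lambda>x. f x - g x)"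
  using smooth_on_add[of f "\<lambda>x. (-1) * g x"] smooth_on_mult[of "\<lambda>_. -1" g] smooth_on_const by simp

lemma smooth_on_divide_const: "smooth_on S f \<Longrightarrow> smooth_on S (\<lambda>x. f x / c)"
  using smooth_on_mult[of f "\<lambda>_. inverse c"] smooth_on_const by (simp add: divide_inverse)

lemma smooth_on_sum:
  "(\<And>a. a \<in> A \<Longrightarrow> smooth_on S (f a)) \<Longrightarrow> smooth_on S (\<lambda>x. \<Sum>a\<in>A. f a x)"
  by (induction A rule: infinite_finite_induct) (auto intro: smooth_on_const smooth_on_add)

lemma smooth_on_inverse:
  "smooth_on S f \<Longrightarrow> (\<And>x. x \<in> S \<Longrightarrow> f x \<noteq> 0) \<Longrightarrow> smooth_on S (\<lambda>x. inverse (f x))"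
  by (simp add: smooth_on_def Ck_on_inverse[OF op])

lemma smooth_on_power: "smooth_on S f \<Longrightarrow> smooth_on S (\<lambda>x. f x ^ k)"
  by (induction k) (auto intro: smooth_on_const smooth_on_mult)

end

lemma smooth_on_bounded_linear: "bounded_linear f \<Longrightarrow> smooth_on S f"
  by (simp add: smooth_on_def Ck_on_bounded_linear)

lemma smooth_on_comp_fst:
  fixes f :: "'a::euclidean_space \<Rightarrow> real" and S :: "('a \<times> 'b::euclidean_space) set"
  assumes "open S" "smooth_on (fst ` S) f"
  shows "smooth_on S (\<lambda>q. f (fst q))"
  using assms by (simp add: smooth_on_def Ck_on_comp_fst)

section \<open>Alternating multilinear forms\<close>

definition multilinear_on_lists :: "nat \<Rightarrow> ('a::real_vector list \<Rightarrow> real) \<Rightarrow> bool" where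
  "multilinear_on_lists k G \<longleftrightarrow>
     (\<forall>vs i. length vs = k \<and> i < k \<longrightarrow> linear (\<lambda>u. G (vs[i := u])))"

text \<open>The algebraic conditions of \<open>differential_form\<close> at a single point.\<close>

definition alternating :: "nat \<Rightarrow> ('a::real_vector list \<Rightarrow> real) \<Rightarrow> bool" where
  "alternating k A \<longleftrightarrow> multilinear_on_lists k A \<and>
     (\<forall>vs. length vs \<noteq> k \<longrightarrow> A vs = 0) \<and>
     (\<forall>vs i j. length vs = k \<and> i < j \<and> j < k \<and> vs ! i = vs ! j \<longrightarrow> A vs = 0)"

lemma multilinear_on_listsD:
  "multilinear_on_lists k G \<Longrightarrow> length vs = k \<Longrightarrow> i < k \<Longrightarrow> linear (\<lambda>u. G (vs[i := u]))"
  by (simp add: multilinear_on_lists_def)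

lemma alternatingI:
  assumes "\<And>vs i. length vs = k \<Longrightarrow> i < k \<Longrightarrow> linear (\<lambda>u. A (vs[i := u]))"
    and "\<And>vs. length vs \<noteq> k \<Longrightarrow> A vs = 0"
    and "\<And>vs i j. length vs = k \<Longrightarrow> i < j \<Longrightarrow> j < k \<Longrightarrow> vs ! i = vs ! j \<Longrightarrow> A vs = 0"
  shows "alternating k A"
  using assms unfolding alternating_def multilinear_on_lists_def by blast

lemma alternating_linear:
  "alternating k A \<Longrightarrow> length vs = k \<Longrightarrow> i < k \<Longrightarrow> linear (\<lambda>u. A (vs[i := u]))"
  by (simp add: alternating_def multilinear_on_lists_def)

lemma alternating_length: "alternating k A \<Longrightarrow> length vs \<noteq> k \<Longrightarrow> A vs = 0"
  by (simp add: alternating_def)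

lemma alternating_repeated:
  assumes "alternating k A" "length vs = k" "i < k" "j < k" "i \<noteq> j" "vs ! i = vs ! j"
  shows "A vs = 0"
  using assms unfolding alternating_def by (metis linorder_neqE_nat)

text \<open>Polarization: the form vanishes when a + b stands in both slots, and expanding leaves
  only the two mixed terms.\<close>

lemma alternating_swap:
  assumes A: "alternating k A" and us: "length us = k" "i < k" "j < k" "i \<noteq> j"
  shows "A (us[i := us ! j, j := us ! i]) = - A us"
proof -
  define B where "B u v = A (us[i := u, j := v])" for u v
  have lv: "linear (B u)" for u
    unfolding B_def using alternating_linear[OF A, of "us[i := u]" j] us by simp
  have "B u v = A (us[j := v, i := u])" for u v
    unfolding B_def using us by (simp add: list_update_swap)
  then have lu: "linear (\<lambda>u. B u v)" for v
    using alternating_linear[OF A, of "us[j := v]" i] us by simp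
  have 0: "B u u = 0" for u
    unfolding B_def by (rule alternating_repeated[OF A, of _ i j]) (use us in auto)
  let ?a = "us ! i" and ?b = "us ! j"
  have "B (?a + ?b) (?a + ?b) = B ?a ?a + B ?a ?b + (B ?b ?a + B ?b ?b)"
    by (simp add: linear_add[OF lu] linear_add[OF lv])
  then have "B ?b ?a = - B ?a ?b"
    by (simp add: 0)
  then show ?thesis
    by (simp add: B_def)
qed

text \<open>Brings the vector inserted by \<open>iprod\<close> from the front to its own slot; the
  sign is the one in \<open>ext_d\<close>.\<close>

lemma alternating_move:
  assumes "alternating k A"
  shows "length (rs @ x # ps @ qs) = k \<Longrightarrow>
    A (rs @ x # ps @ qs) = (- 1) ^ length ps * A (rs @ ps @ x # qs)"
proof (induction ps arbitrary: rs)
  case (Cons p ps)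
  have "A (rs @ p # x # ps @ qs) = - A (rs @ x # p # ps @ qs)"
    using alternating_swap[OF assms, of "rs @ x # p # ps @ qs" "length rs" "Suc (length rs)"] Cons.prems
    by (simp add: nth_append list_update_append)
  moreover have "A ((rs @ [p]) @ x # ps @ qs) = (- 1) ^ length ps * A ((rs @ [p]) @ ps @ x # qs)"
    by (rule Cons.IH) (use Cons.prems in simp)
  ultimately show ?case by simp
qed simp

text \<open>Forms of top degree span a line: here k is the dimension, and one ordered basis decides.
  Swaps sort any list of distinct basis vectors, repetitions give 0, and multilinearity does the
  rest.\<close>

lemma alternating_eq_0:
  fixes A :: "'a::euclidean_space list \<Rightarrow> real"
  assumes A: "alternating k A" and bs: "distinct bs" "set bs = Basis" "length bs = k" "A bs = 0"
  shows "A us = 0"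
proof (cases "length us = k")
  case False
  then show ?thesis using alternating_length[OF A] by blast
next
  case True
  \<comment> \<open>The number m counts leading entries that already agree with \<open>bs\<close>;
    the induction runs downward from full agreement, and each step swaps the next vector of
    \<open>bs\<close> into place.\<close>
  have basis: "A us = 0" if "m \<le> k" "length us = k" "set us \<subseteq> Basis" "take m us = take m bs" for m us
    using that
  proof (induction m arbitrary: us rule: inc_induct)
    case base
    then show ?case using bs by simp
  next
    case (step m)
    show ?case
    proof (cases "distinct us")
      case False
      then obtain i j where "i < k" "j < k" "i \<noteq> j" "us ! i = us ! j"
        using step.prems by (auto simp: distinct_conv_nth)
      then show ?thesis
        using alternating_repeated[OF A] step.prems by blast
    next
      case True
      have "card (set us) = card (Basis :: 'a set)"
        using True bs step.prems by (metis distinct_card)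
      then have "set us = Basis"
        using step.prems by (simp add: card_subset_eq)
      then obtain j where j: "j < k" "us ! j = bs ! m"
        using bs step by (metis in_set_conv_nth nth_mem)
      have jm: "m \<le> j"
      proof (rule ccontr)
        assume "\<not> m \<le> j"
        then have "us ! j = bs ! j"
          using step.prems by (metis not_le nth_take)
        then show False
          using \<open>\<not> m \<le> j\<close> j bs step by (simp add: nth_eq_iff_index_eq)
      qed
      define ws where "ws = us[m := us ! j, j := us ! m]"
      have "A ws = 0"
      proof (rule step.IH)
        show "take (Suc m) ws = take (Suc m) bs"
        proof (rule nth_equalityI)
          fix i assume "i < length (take (Suc m) ws)"
          then have i: "i \<le> m" "i < k"
            using step by (auto simp: ws_def)
          have "us ! i = bs ! i" if "i < m"
            using that step.prems by (metis nth_take)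
          then have "ws ! i = bs ! i"
            using i j jm step.prems step.hyps unfolding ws_def
            by (cases "i = m"; cases "j = m"; simp add: nth_list_update)
          then show "take (Suc m) ws ! i = take (Suc m) bs ! i"
            using i by simp
        qed (use step.prems step.hyps bs in \<open>simp add: ws_def\<close>)
        show "set ws \<subseteq> Basis"
          using step.prems step.hyps j unfolding ws_def
          by (metis nth_mem set_update_subsetI subsetD)
      qed (use step.prems in \<open>simp add: ws_def\<close>)
      then show ?thesis
        using alternating_swap[OF A, of us m j] step.prems step.hyps j
        by (cases "j = m") (auto simp: ws_def)
    qed
  qed
  \<comment> \<open>Expansion in the basis, one slot at a time: from slot m on the entries are basis
    vectors already.\<close>
  have "A us = 0" if "m \<le> k" "length us = k" "\<forall>i. m \<le> i \<and> i < k \<longrightarrow> us ! i \<in> Basis" for m us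
    using that
  proof (induction m arbitrary: us)
    case 0
    then show ?case
      using basis[of 0 us] by (metis in_set_conv_nth le0 subsetI take0)
  next
    case (Suc m)
    have lin: "linear (\<lambda>u. A (us[m := u]))"
      using alternating_linear[OF A] Suc.prems by simp
    have "A us = A (us[m := (\<Sum>b\<in>Basis. (us ! m \<bullet> b) *\<^sub>R b)])"
      by (simp add: euclidean_representation)
    also have "\<dots> = (\<Sum>b\<in>Basis. (us ! m \<bullet> b) *\<^sub>R A (us[m := b]))"
      by (simp add: linear_sum[OF lin] linear_cmul[OF lin])
    also have "\<dots> = 0"
    proof (intro sum.neutral ballI)
      fix b :: 'a assume "b \<in> Basis"
      then have "A (us[m := b]) = 0"
        using Suc.prems by (intro Suc.IH) (auto simp: nth_list_update)
      then show "(us ! m \<bullet> b) *\<^sub>R A (us[m := b]) = 0" by simp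
    qed
    finally show ?case .
  qed
  from this[OF order_refl True] show ?thesis by (meson not_le)
qed

lemma alternating_diff:
  assumes "alternating k A" "alternating k B"
  shows "alternating k (\<lambda>vs. A vs - B vs)"
  using assms unfolding alternating_def multilinear_on_lists_def
  by (auto intro: linear_compose_sub)

lemma alternating_scale:
  assumes "alternating k A"
  shows "alternating k (\<lambda>vs. c * A vs)"
  using assms unfolding alternating_def multilinear_on_lists_def
  by (auto intro: linear_compose_scale_right[where 'b = real, simplified])

lemma alternating_map:
  assumes A: "alternating k A" and L: "linear L"
  shows "alternating k (\<lambda>vs. A (map L vs))"
proof (rule alternatingI)
  show "linear (\<lambda>u. A (map L (vs[i := u])))" if "length vs = k" "i < k" for vs i
    using linear_compose[OF L alternating_linear[OF A, of "map L vs" i]] that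
    by (simp add: o_def map_update)
  show "A (map L vs) = 0" if "length vs \<noteq> k" for vs
    using alternating_length[OF A] that by simp
  show "A (map L vs) = 0" if "length vs = k" "i < j" "j < k" "vs ! i = vs ! j" for vs i j
    by (rule alternating_repeated[OF A, of _ i j]) (use that in auto)
qed

text \<open>The derivation induced by L on forms of top degree is again alternating, hence a
  multiple of A; evaluation on a basis identifies the factor as the trace. This is how the
  divergence enters the Lie derivative.\<close>

lemma alternating_trace:
  fixes A :: "'a::euclidean_space list \<Rightarrow> real"
  assumes A: "alternating DIM('a) A" and L: "linear L" and us: "length us = DIM('a)"
  shows "(\<Sum>i<DIM('a). A (us[i := L (us ! i)])) = (\<Sum>b\<in>Basis. L b \<bullet> b) * A us"
proof -
  let ?k = "DIM('a)"
  define D where "D vs = (if length vs = ?k then \<Sum>i<?k. A (vs[i := L (vs ! i)]) else 0)" for vs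
  have "alternating ?k D"
  proof (rule alternatingI)
    fix vs :: "'a list" and j
    assume vs: "length vs = ?k" "j < ?k"
    have "linear (\<lambda>u. A (vs[j := u, i := L (vs[j := u] ! i)]))" if i: "i < ?k" for i
    proof (cases "i = j")
      case True
      then show ?thesis
        using linear_compose[OF L alternating_linear[OF A vs]] vs by (simp add: o_def)
    next
      case False
      then show ?thesis
        using alternating_linear[OF A, of "vs[i := L (vs ! i)]" j] vs
        by (simp add: list_update_swap[of j i])
    qed
    then show "linear (\<lambda>u. D (vs[j := u]))"
      unfolding D_def using vs by (simp add: linear_compose_sum)
  next
    fix vs :: "'a list" and p q
    assume vs: "length vs = ?k" "p < q" "q < ?k" "vs ! p = vs ! q"
    define a where "a = vs ! p"
    have a: "vs ! p = a" "vs ! q = a"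
      using vs by (simp_all add: a_def)
    have "A (vs[i := L (vs ! i)]) = 0" if "i < ?k" "i \<noteq> p" "i \<noteq> q" for i
      by (rule alternating_repeated[OF A, of _ p q]) (use that vs in auto)
    then have "(\<Sum>i<?k. A (vs[i := L (vs ! i)])) = (\<Sum>i\<in>{p, q}. A (vs[i := L (vs ! i)]))"
      by (intro sum.mono_neutral_right) (use vs in auto)
    also have "\<dots> = A (vs[p := L a]) + A (vs[q := L a])"
      using vs a by simp
    \<comment> \<open>Of all substitutions, only those in the two slots holding a survive; their
      lists differ by exchanging these slots, so the values cancel.\<close>
    also have "vs[q := L a] = vs[p := L a, p := vs[p := L a] ! q, q := vs[p := L a] ! p]"
      by (rule nth_equalityI) (use vs a in \<open>auto simp: nth_list_update\<close>)
    also have "A \<dots> = - A (vs[p := L a])"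
      using alternating_swap[OF A, of "vs[p := L a]" p q] vs by simp
    finally show "D vs = 0"
      using vs by (simp add: D_def)
  qed (simp add: D_def)
  then have alt: "alternating ?k (\<lambda>vs. D vs - (\<Sum>b\<in>Basis. L b \<bullet> b) * A vs)"
    by (intro alternating_diff alternating_scale A)
  obtain bs :: "'a list" where bs: "set bs = Basis" "distinct bs"
    using finite_distinct_list[OF finite_Basis] by blast
  then have len: "length bs = ?k"
    by (metis distinct_card)
  have "A (bs[i := L (bs ! i)]) = (L (bs ! i) \<bullet> bs ! i) * A bs" if i: "i < ?k" for i
  proof -
    have lin: "linear (\<lambda>u. A (bs[i := u]))"
      using alternating_linear[OF A len i] .
    have "bs ! i \<in> Basis"
      using i len bs(1) nth_mem[of i bs] by simp
    have "A (bs[i := L (bs ! i)]) = A (bs[i := (\<Sum>b\<in>Basis. (L (bs ! i) \<bullet> b) *\<^sub>R b)])"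
      by (simp add: euclidean_representation)
    also have "\<dots> = (\<Sum>b\<in>Basis. (L (bs ! i) \<bullet> b) * A (bs[i := b]))"
      by (simp add: linear_sum[OF lin] linear_cmul[OF lin])
    \<comment> \<open>Every other basis vector already occupies a different slot.\<close>
    also have "\<dots> = (\<Sum>b\<in>{bs ! i}. (L (bs ! i) \<bullet> b) * A (bs[i := b]))"
    proof (rule sum.mono_neutral_right)
      show "\<forall>b\<in>Basis - {bs ! i}. (L (bs ! i) \<bullet> b) * A (bs[i := b]) = 0"
      proof
        fix b assume b: "b \<in> Basis - {bs ! i}"
        then obtain j where j: "j < ?k" "b = bs ! j"
          using bs len by (metis DiffD1 in_set_conv_nth)
        then have "A (bs[i := b]) = 0"
          using b i len by (intro alternating_repeated[OF A, of _ i j]) (auto simp: nth_list_update)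
        then show "(L (bs ! i) \<bullet> b) * A (bs[i := b]) = 0" by simp
      qed
    qed (use \<open>bs ! i \<in> Basis\<close> in simp_all)
    finally show ?thesis by simp
  qed
  moreover have "(\<Sum>i<?k. L (bs ! i) \<bullet> bs ! i) = (\<Sum>b\<in>Basis. L b \<bullet> b)"
    by (rule sum.reindex_bij_betw) (use bij_betw_nth[OF bs(2)] bs len in simp)
  ultimately have "D bs = (\<Sum>b\<in>Basis. L b \<bullet> b) * A bs"
    using len by (simp add: D_def sum_distrib_right[symmetric])
  then show ?thesis
    using alternating_eq_0[OF alt bs(2,1) len, of us] us by (simp add: D_def)
qed

section \<open>Antisymmetrization without the factor 1/k!\<close>

definition antisymmetrization :: "nat \<Rightarrow> ('a list \<Rightarrow> real) \<Rightarrow> 'a list \<Rightarrow> real" where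
  "antisymmetrization k G vs = (if length vs = k
     then \<Sum>\<sigma> | \<sigma> permutes {..<k}. of_int (sign \<sigma>) * G (map (\<lambda>i. vs ! \<sigma> i) [0..<k]) else 0)"

lemma sign_compose_permutes:
  assumes "finite S" "\<sigma> permutes S" "\<tau> permutes S"
  shows "sign (\<sigma> \<circ> \<tau>) = sign \<sigma> * sign \<tau>"
  using assms sign_compose permutation_permutes by blast

lemma alternating_antisymmetrization:
  assumes G: "multilinear_on_lists k G"
  shows "alternating k (antisymmetrization k G)"
proof (rule alternatingI)
  fix vs :: "'a list" and j
  assume vs: "length vs = k" "j < k"
  have "linear (\<lambda>u. G (map (\<lambda>i. vs[j := u] ! \<sigma> i) [0..<k]))" if \<sigma>: "\<sigma> permutes {..<k}" for \<sigma>
  proof -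
    \<comment> \<open>After permutation, the varying slot j shows up at exactly one position
      l.\<close>
    obtain l where l: "l < k" "\<sigma> l = j"
      using permutes_image[OF \<sigma>] vs(2) by (metis image_iff lessThan_iff)
    have "map (\<lambda>i. vs[j := u] ! \<sigma> i) [0..<k] = (map (\<lambda>i. vs ! \<sigma> i) [0..<k])[l := u]" for u
    proof (rule nth_equalityI)
      fix i assume "i < length (map (\<lambda>i. vs[j := u] ! \<sigma> i) [0..<k])"
      then show "map (\<lambda>i. vs[j := u] ! \<sigma> i) [0..<k] ! i = (map (\<lambda>i. vs ! \<sigma> i) [0..<k])[l := u] ! i"
        using l vs permutes_inj[OF \<sigma>] by (auto simp: nth_list_update inj_eq)
    qed simp
    then show ?thesis
      using multilinear_on_listsD[OF G, of "map (\<lambda>i. vs ! \<sigma> i) [0..<k]" l] l by simp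
  qed
  then have "linear (\<lambda>u. of_int (sign \<sigma>) * G (map (\<lambda>i. vs[j := u] ! \<sigma> i) [0..<k]))"
    if "\<sigma> permutes {..<k}" for \<sigma>
    using linear_compose_scale_right[OF _, of "\<lambda>u. G (map (\<lambda>i. vs[j := u] ! \<sigma> i) [0..<k])" "of_int (sign \<sigma>)"] that by simp
  then show "linear (\<lambda>u. antisymmetrization k G (vs[j := u]))"
    using vs by (simp add: antisymmetrization_def linear_compose_sum)
next
  fix vs :: "'a list" and i j
  assume vs: "length vs = k" "i < j" "j < k" "vs ! i = vs ! j"
  let ?\<tau> = "Transposition.transpose i j"
  let ?g = "\<lambda>\<sigma>. of_int (sign \<sigma>) * G (map (\<lambda>i. vs ! \<sigma> i) [0..<k])"
  have \<tau>: "?\<tau> permutes {..<k}"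
    using vs by (intro permutes_swap_id) auto
  \<comment> \<open>Transposing the two equal arguments changes nothing but the sign, so reindexing
    the sum by the transposition shows that it equals its own negative.\<close>
  have "?g (?\<tau> \<circ> \<sigma>) = - ?g \<sigma>" if "\<sigma> permutes {..<k}" for \<sigma>
  proof -
    have "vs ! (?\<tau> l) = vs ! l" for l
      using vs by (auto simp: Transposition.transpose_def)
    then show ?thesis
      using sign_compose_permutes[OF _ \<tau> that] vs by (simp add: sign_swap_id)
  qed
  then have "sum (\<lambda>\<sigma>. ?g (?\<tau> \<circ> \<sigma>)) {\<sigma>. \<sigma> permutes {..<k}} = sum (\<lambda>\<sigma>. - ?g \<sigma>) {\<sigma>. \<sigma> permutes {..<k}}"
    by (intro sum.cong) blast+
  then have "sum ?g {\<sigma>. \<sigma> permutes {..<k}} = - sum ?g {\<sigma>. \<sigma> permutes {..<k}}"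
    using setum_permutations_compose_left[OF \<tau>, of ?g] by (simp only: sum_negf)
  then show "antisymmetrization k G vs = 0"
    using vs by (simp add: antisymmetrization_def)
qed (simp add: antisymmetrization_def)

section \<open>The standard volume form\<close>

text \<open>
  \<^term>\<open>pairing i j\<close> is the value on the basis vectors number \<open>i\<close> and \<open>j\<close> of the standard symplectic
  form on the span of the vectors number \<open>1, 2, \<dots>\<close>, in which \<open>2j + 1\<close> and \<open>2j + 2\<close> are conjugate;
  the vector number \<open>0\<close> is the Reeb direction.
\<close>

definition pairing :: "nat \<Rightarrow> nat \<Rightarrow> real" where
  "pairing i j = (if odd i \<and> j = Suc i then 1 else if odd j \<and> i = Suc j then - 1 else 0)"

text \<open>The term of \<sigma> in the alternating sum for \<lambda> \<and> d\<lambda> \<and> ...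
  \<and> d\<lambda> with m factors d\<lambda>, evaluated on a Darboux basis at the origin. There the
  contact form is 1 on the vector number 0 and vanishes on all others.\<close>

definition pairing_term :: "nat \<Rightarrow> (nat \<Rightarrow> nat) \<Rightarrow> real" where
  "pairing_term m \<sigma> = of_int (sign \<sigma>) * ((if \<sigma> 0 = 0 then 1 else 0)
     * (\<Prod>j<m. pairing (\<sigma> (2 * j + 1)) (\<sigma> (2 * j + 2))))"

lemma pairing_antisym: "pairing j i = - pairing i j"
  by (auto simp: pairing_def)

lemma pairing_nonzero: "pairing i j \<noteq> 0 \<Longrightarrow> odd i \<and> j = Suc i \<or> odd j \<and> i = Suc j"
  by (auto simp: pairing_def split: if_splits)

lemma pairing_term_swap_pairs:
  assumes \<sigma>: "\<sigma> permutes {..<2 * m + 1}" and j: "j < m" "l < m"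
  shows "pairing_term m (\<sigma> \<circ> (Transposition.transpose (2 * j + 1) (2 * l + 1)
      \<circ> Transposition.transpose (2 * j + 2) (2 * l + 2))) = pairing_term m \<sigma>"
proof -
  let ?a = "Transposition.transpose (2 * j + 1) (2 * l + 1)"
  let ?b = "Transposition.transpose (2 * j + 2) (2 * l + 2)"
  let ?t = "Transposition.transpose j l"
  have a: "?a permutes {..<2 * m + 1}" and b: "?b permutes {..<2 * m + 1}"
    using j by (auto intro!: permutes_swap_id)
  have "sign (\<sigma> \<circ> (?a \<circ> ?b)) = sign \<sigma> * (sign ?a * sign ?b)"
    using sign_compose_permutes[OF _ \<sigma> permutes_compose[OF b a]]
      sign_compose_permutes[OF _ a b] by simp
  \<comment> \<open>Two odd transpositions if j and l differ, two identities if they agree; the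
    second case occurs when the wanted pair is already in last place.\<close>
  also have "sign ?a * sign ?b = 1"
    by (simp add: sign_swap_id)
  finally have sgn: "sign (\<sigma> \<circ> (?a \<circ> ?b)) = sign \<sigma>" by (simp only: mult_1_right)
  have odd: "(?a \<circ> ?b) (2 * i + 1) = 2 * ?t i + 1" for i
    by (auto simp: Transposition.transpose_def; presburger)
  have even: "(?a \<circ> ?b) (2 * i + 2) = 2 * ?t i + 2" for i
    by (auto simp: Transposition.transpose_def; presburger)
  have zero: "(?a \<circ> ?b) 0 = 0"
    by (simp add: Transposition.transpose_def)
  have "(\<Prod>i<m. pairing (\<sigma> (2 * ?t i + 1)) (\<sigma> (2 * ?t i + 2)))
      = (\<Prod>i<m. pairing (\<sigma> (2 * i + 1)) (\<sigma> (2 * i + 2)))"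
    by (rule prod.reindex_bij_betw[of ?t "{..<m}" "{..<m}" "\<lambda>i. pairing (\<sigma> (2 * i + 1)) (\<sigma> (2 * i + 2))"])
      (use j in \<open>auto intro!: permutes_imp_bij permutes_swap_id\<close>)
  then show ?thesis
    unfolding pairing_term_def sgn o_apply[of \<sigma>] odd even zero by simp
qed

lemma pairing_term_flip:
  assumes \<sigma>: "\<sigma> permutes {..<2 * m + 1}" and j: "j < m"
  shows "pairing_term m (\<sigma> \<circ> Transposition.transpose (2 * j + 1) (2 * j + 2)) = pairing_term m \<sigma>"
proof -
  let ?a = "Transposition.transpose (2 * j + 1) (2 * j + 2)"
  have a: "?a permutes {..<2 * m + 1}"
    using j by (auto intro!: permutes_swap_id)
  have sgn: "sign (\<sigma> \<circ> ?a) = - sign \<sigma>"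
    using sign_compose_permutes[OF _ \<sigma> a] by (simp add: sign_swap_id)
  have rest: "?a (2 * i + 1) = 2 * i + 1" "?a (2 * i + 2) = 2 * i + 2" if "i \<noteq> j" for i
    using that by (auto simp: Transposition.transpose_def)
  have at_j: "?a (2 * j + 1) = 2 * j + 2" "?a (2 * j + 2) = 2 * j + 1" "?a 0 = 0"
    by (auto simp: Transposition.transpose_def)
  let ?f = "\<lambda>\<sigma> i. pairing (\<sigma> (2 * i + 1)) (\<sigma> (2 * i + 2))"
  have split: "prod g {..<m} = g j * prod g ({..<m} - {j})" for g :: "nat \<Rightarrow> real"
    using j by (intro prod.remove) auto
  have "prod (?f (\<sigma> \<circ> ?a)) ({..<m} - {j}) = prod (?f \<sigma>) ({..<m} - {j})"
    by (rule prod.cong) (use rest in \<open>auto simp del: One_nat_def\<close>)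
  moreover have "?f (\<sigma> \<circ> ?a) j = - ?f \<sigma> j"
    unfolding o_apply at_j by (rule pairing_antisym)
  ultimately have "prod (?f (\<sigma> \<circ> ?a)) {..<m} = - prod (?f \<sigma>) {..<m}"
    unfolding split by simp
  then show ?thesis
    unfolding pairing_term_def sgn by (simp add: at_j(3)[simplified])
qed

text \<open>
  A nonzero term comes from a permutation that preserves the set of conjugate pairs. Permuting whole
  pairs is even, and each exchange inside a pair changes both the sign and one factor.
\<close>

lemma pairing_term_nonneg: "\<sigma> permutes {..<2 * m + 1} \<Longrightarrow> 0 \<le> pairing_term m \<sigma>"
proof (induction m arbitrary: \<sigma>)
  case 0
  then have "\<sigma> = id"
    by (auto simp: lessThan_Suc permutes_sing)
  then show ?case
    by (simp add: pairing_term_def)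
next
  case (Suc m)
  show ?case
  proof (cases "pairing_term (Suc m) \<sigma> = 0")
    case False
    then have zero: "\<sigma> 0 = 0"
      and nz: "pairing (\<sigma> (2 * j + 1)) (\<sigma> (2 * j + 2)) \<noteq> 0" if "j < Suc m" for j
      using that by (auto simp: pairing_term_def prod_zero_iff simp del: prod.lessThan_Suc split: if_splits)
    \<comment> \<open>The pair of slots carrying the largest index is moved to the end, so that the
      permutation can be restricted to the smaller range.\<close>
    have "2 * m + 2 \<in> \<sigma> ` {..<2 * Suc m + 1}"
      using permutes_image[OF Suc.prems] by simp
    then obtain i where i: "i < 2 * Suc m + 1" "\<sigma> i = 2 * m + 2"
      by auto
    have "i \<noteq> 0"
      using i zero[of 0] by (cases i) auto
    define j where "j = (i - 1) div 2"
    have j: "j < Suc m" "i = 2 * j + 1 \<or> i = 2 * j + 2"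
      using i \<open>i \<noteq> 0\<close> unfolding j_def by auto
    have inv_bound: "\<sigma> k < 2 * Suc m + 1" if "k < 2 * Suc m + 1" for k
      using permutes_in_image[OF Suc.prems, of k] that by simp
    \<comment> \<open>A positive even index is conjugate only to its predecessor.\<close>
    have pair: "{\<sigma> (2 * j + 1), \<sigma> (2 * j + 2)} = {2 * m + 1, 2 * m + 2}"
      using pairing_nonzero[OF nz[OF j(1)]] j(2) i(2) inv_bound[of "2 * j + 1"] inv_bound[of "2 * j + 2"] j(1)
      by auto
    define \<tau> where "\<tau> = Transposition.transpose (2 * j + 1) (2 * m + 1)
      \<circ> Transposition.transpose (2 * j + 2) (2 * m + 2)"
    define \<rho> where "\<rho> = \<sigma> \<circ> \<tau>"
    have \<tau>: "\<tau> permutes {..<2 * Suc m + 1}"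
      unfolding \<tau>_def using j(1) by (intro permutes_compose permutes_swap_id) auto
    have \<rho>: "\<rho> permutes {..<2 * Suc m + 1}" "pairing_term (Suc m) \<rho> = pairing_term (Suc m) \<sigma>"
      unfolding \<rho>_def using permutes_compose[OF \<tau> Suc.prems]
        pairing_term_swap_pairs[OF Suc.prems j(1), of m] by (simp_all add: \<tau>_def)
    have "\<tau> (2 * m + 1) = 2 * j + 1" "\<tau> (2 * m + 2) = 2 * j + 2"
      unfolding \<tau>_def by ((auto simp: Transposition.transpose_def; presburger)+)
    then have "{\<rho> (2 * m + 1), \<rho> (2 * m + 2)} = {2 * m + 1, 2 * m + 2}"
      using pair unfolding \<rho>_def o_apply by simp
    then consider "\<rho> (2 * m + 1) = 2 * m + 1" "\<rho> (2 * m + 2) = 2 * m + 2"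
      | "\<rho> (2 * m + 1) = 2 * m + 2" "\<rho> (2 * m + 2) = 2 * m + 1"
      by (auto simp: doubleton_eq_iff)
    \<comment> \<open>If the last two indices come in the wrong order, a flip inside the pair
      repairs this without changing the term.\<close>
    then obtain \<pi> where \<pi>: "\<pi> permutes {..<2 * Suc m + 1}"
        "pairing_term (Suc m) \<pi> = pairing_term (Suc m) \<sigma>"
        "\<pi> (2 * m + 1) = 2 * m + 1" "\<pi> (2 * m + 2) = 2 * m + 2"
    proof cases
      case 1
      then show ?thesis using that \<rho> by blast
    next
      case 2
      let ?a = "Transposition.transpose (2 * m + 1) (2 * m + 2)"
      have "?a permutes {..<2 * Suc m + 1}"
        by (intro permutes_swap_id) auto
      then show ?thesis
        using that[of "\<rho> \<circ> ?a"] permutes_compose[OF _ \<rho>(1), of ?a] 2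
          pairing_term_flip[OF \<rho>(1), of m] \<rho>(2) by simp
    qed
    have "\<pi> permutes {..<2 * m + 1}"
    proof (rule permutes_superset[OF \<pi>(1)])
      fix x assume "x \<in> {..<2 * Suc m + 1} - {..<2 * m + 1}"
      then have "x = 2 * m + 1 \<or> x = 2 * m + 2" by auto
      then show "\<pi> x = x" using \<pi>(3,4) by blast
    qed
    then have "0 \<le> pairing_term m \<pi>"
      by (rule Suc.IH)
    moreover have "pairing_term (Suc m) \<pi> = pairing_term m \<pi> * pairing (\<pi> (2 * m + 1)) (\<pi> (2 * m + 2))"
      by (simp add: pairing_term_def mult.assoc)
    moreover have "pairing (\<pi> (2 * m + 1)) (\<pi> (2 * m + 2)) = 1"
      unfolding \<pi>(3,4) by (simp add: pairing_def)
    ultimately show ?thesis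
      using \<pi>(2) by simp
  qed simp
qed

lemma pairing_term_id: "pairing_term m id = 1"
  by (simp add: pairing_term_def pairing_def)

lemma sum_pairing_term_pos:
  "0 < (\<Sum>\<sigma> | \<sigma> permutes {..<2 * m + 1}. pairing_term m \<sigma>)"
  by (rule sum_pos2[of _ id])
    (use pairing_term_nonneg in \<open>auto simp: finite_permutations permutes_id pairing_term_id\<close>)

section \<open>The contact form and its wedge powers in coordinates\<close>

definition contact_covector :: "('n::finite) phase \<Rightarrow> 'n phase \<Rightarrow> real" where
  "contact_covector = (\<lambda>(x, y, p, w, z) (dx, dy, dp, dw, dz). dz - p \<bullet> dx - w * dy)"

text \<open>The two-form dx \<and> dp + dy \<and> dw, which is d\<lambda>; it does not depend on the
  base point.\<close>

definition symplectic :: "('n::finite) phase \<Rightarrow> 'n phase \<Rightarrow> real" where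
  "symplectic = (\<lambda>(x, y, p, w, z) (x', y', p', w', z'). x \<bullet> p' + y * w' - x' \<bullet> p - y' * w)"

lemma contact_form_eq:
  "contact_form q vs = (if length vs = 1 then contact_covector q (hd vs) else 0)"
  by (cases vs; cases "tl vs")
    (auto simp: contact_form_def contact_covector_def inner_vec_def split: prod.splits)

lemma linear_contact_covector: "linear (contact_covector q)"
  by (rule linearI) (auto simp: contact_covector_def algebra_simps inner_simps split: prod.splits)

lemma linear_symplectic_right: "linear (symplectic u)"
  by (rule linearI) (auto simp: symplectic_def algebra_simps inner_simps split: prod.splits)

lemma symplectic_antisym: "symplectic v u = - symplectic u v"
  by (auto simp: symplectic_def split: prod.splits)

lemma linear_symplectic_left: "linear (\<lambda>u. symplectic u v)"
  using linear_compose_neg[OF linear_symplectic_right[of v]] by (simp add: symplectic_antisym[of _ v])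

lemma contact_covector_has_derivative:
  "((\<lambda>q. contact_covector q v) has_derivative
     (\<lambda>u. - (fst (snd (snd u)) \<bullet> fst v) - fst (snd (snd (snd u))) * fst (snd v))) (at q)"
proof -
  have "contact_covector q v = snd (snd (snd (snd v))) - fst (snd (snd q)) \<bullet> fst v
      - fst (snd (snd (snd q))) * fst (snd v)" for q
    by (simp add: contact_covector_def split: prod.splits)
  then show ?thesis
    by (auto intro!: derivative_eq_intros)
qed

lemma ext_d_contact_form:
  "ext_d contact_form q vs = (if length vs = 2 then symplectic (vs ! 0) (vs ! 1) else 0)"
proof (cases "length vs = 2")
  case True
  then obtain u v where vs: "vs = [u, v]"
    by (auto simp: length_Suc_conv numeral_2_eq_2)
  have "frechet_derivative (\<lambda>q. contact_covector q v) (at q) u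
      = - (fst (snd (snd u)) \<bullet> fst v) - fst (snd (snd (snd u))) * fst (snd v)"
    for u v q :: "'a phase"
    by (simp only: frechet_derivative_at[OF contact_covector_has_derivative, symmetric])
  then show ?thesis
    unfolding vs ext_d_def
    by (simp add: contact_form_eq symplectic_def inner_commute mult.commute split: prod.splits)
next
  case False
  have "(\<lambda>y. contact_form y (take i vs @ drop (Suc i) vs)) = (\<lambda>_. 0)" if "i < length vs" for i
    using False that by (auto simp: contact_form_eq)
  then show ?thesis
    using False by (simp add: ext_d_def)
qed

definition contact_power :: "nat \<Rightarrow> ('n::finite) phase dform" where
  "contact_power m = ((\<lambda>\<omega>. \<omega> \<and>\<^sub>F ext_d contact_form) ^^ m) contact_form"

text \<open>The tensor product underlying the wedge power: slot 0 goes to the contact form, and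
  slots 2j + 1 and 2j + 2 go to the factor number j.\<close>

definition contact_product :: "nat \<Rightarrow> ('n::finite) phase \<Rightarrow> 'n phase list \<Rightarrow> real" where
  "contact_product m q ws
     = contact_covector q (ws ! 0) * (\<Prod>j<m. symplectic (ws ! (2 * j + 1)) (ws ! (2 * j + 2)))"

lemma standard_volume_eq: "standard_volume = (contact_power (CARD('n) + 1) :: ('n::finite) phase dform)"
  by (simp add: standard_volume_def contact_power_def)

lemma contact_product_Suc_permuted:
  "contact_product (Suc m) q (map f [0..<2 * m + 3])
    = contact_product m q (map f [0..<2 * m + 1])
      * ext_d contact_form q (map f [2 * m + 1..<2 * m + 3])"
proof -
  have "[2 * m + 1..<2 * m + 3] = [2 * m + 1, 2 * m + 2]"
    by (simp add: upt_rec)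
  then have "ext_d contact_form q (map f [2 * m + 1..<2 * m + 3])
      = symplectic (f (2 * m + 1)) (f (2 * m + 2))"
    by (simp add: ext_d_contact_form)
  moreover have "(\<Prod>j<m. symplectic (map f [0..<2 * m + 3] ! (2 * j + 1)) (map f [0..<2 * m + 3] ! (2 * j + 2)))
      = (\<Prod>j<m. symplectic (map f [0..<2 * m + 1] ! (2 * j + 1)) (map f [0..<2 * m + 1] ! (2 * j + 2)))"
    by (rule prod.cong) (auto simp del: upt_Suc)
  moreover have "map f [0..<2 * m + 3] ! 0 = map f [0..<2 * m + 1] ! 0"
    "map f [0..<2 * m + 3] ! (2 * m + 1) = f (2 * m + 1)"
    "map f [0..<2 * m + 3] ! (2 * m + 2) = f (2 * m + 2)"
    by (simp_all del: upt_Suc)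
  ultimately show ?thesis
    unfolding contact_product_def prod.lessThan_Suc by simp
qed

text \<open>In each wedge product, antisymmetrizing an already antisymmetrized factor repeats every
  permutation K! times, where K is its degree. This cancels the first factorial of
  \<open>wedge\<close>; the second one, 2!, leaves a factor 1/2 for each copy of d\<lambda>.\<close>

lemma contact_power_eq:
  "contact_power m q vs = 1 / 2 ^ m * antisymmetrization (2 * m + 1) (contact_product m q) vs"
proof (induction m arbitrary: vs)
  case 0
  show ?case
    by (cases vs) (auto simp: contact_power_def antisymmetrization_def contact_product_def
        contact_form_eq lessThan_Suc permutes_sing)
next
  case (Suc m)
  let ?K = "2 * m + 1" and ?M = "length vs" and ?\<eta> = "ext_d contact_form :: 'a phase dform"
  define S where "S k = (\<Sum>\<sigma> | \<sigma> permutes {..<?M}. of_int (sign \<sigma>)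
      * contact_power m q (map (\<lambda>i. vs ! \<sigma> i) [0..<k]) * ?\<eta> q (map (\<lambda>i. vs ! \<sigma> i) [k..<?M]))" for k
  have wedge: "contact_power (Suc m) q vs = (\<Sum>k\<le>?M. S k / (fact k * fact (?M - k)))"
    by (simp add: contact_power_def wedge_def S_def Let_def)
  \<comment> \<open>By degree, only the split into 2m + 1 and 2 arguments contributes.\<close>
  have S0: "S k = 0" if "k \<le> ?M" "k \<noteq> ?K \<or> ?M \<noteq> ?K + 2" for k
    unfolding S_def
  proof (intro sum.neutral ballI)
    fix \<sigma>
    have "contact_power m q (map (\<lambda>i. vs ! \<sigma> i) [0..<k]) = 0 \<or> ?\<eta> q (map (\<lambda>i. vs ! \<sigma> i) [k..<?M]) = 0"
      using that by (auto simp: Suc.IH antisymmetrization_def ext_d_contact_form)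
    then show "of_int (sign \<sigma>) * contact_power m q (map (\<lambda>i. vs ! \<sigma> i) [0..<k])
        * ?\<eta> q (map (\<lambda>i. vs ! \<sigma> i) [k..<?M]) = 0"
      by auto
  qed
  show ?case
  proof (cases "?M = ?K + 2")
    case False
    then have "contact_power (Suc m) q vs = 0"
      unfolding wedge using S0 by (intro sum.neutral) auto
    then show ?thesis
      using False by (simp add: antisymmetrization_def)
  next
    case True
    let ?P = "{\<sigma>. \<sigma> permutes {..<?M}}" and ?Q = "{\<tau>. \<tau> permutes {..<?K}}"
    define \<Phi> where "\<Phi> \<rho> = of_int (sign \<rho>) * (contact_product m q (map (\<lambda>i. vs ! \<rho> i) [0..<?K])
      * ?\<eta> q (map (\<lambda>i. vs ! \<rho> i) [?K..<?M]))" for \<rho>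
    define c :: real where "c = fact ?K"
    have "c \<noteq> 0" by (simp only: c_def fact_nonzero not_False_eq_True)
    have QP: "\<tau> permutes {..<?M}" if "\<tau> \<in> ?Q" for \<tau>
      using that permutes_subset[of \<tau> "{..<?K}" "{..<?M}"] True by auto
    have summand: "of_int (sign \<sigma>) * (of_int (sign \<tau>) * contact_product m q (map (\<lambda>i. map (\<lambda>i. vs ! \<sigma> i) [0..<?K] ! \<tau> i) [0..<?K]))
        * ?\<eta> q (map (\<lambda>i. vs ! \<sigma> i) [?K..<?M]) = \<Phi> (\<sigma> \<circ> \<tau>)" if \<sigma>: "\<sigma> \<in> ?P" and \<tau>: "\<tau> \<in> ?Q" for \<sigma> \<tau>
    proof -
      have 1: "map (\<lambda>i. map (\<lambda>i. vs ! \<sigma> i) [0..<?K] ! \<tau> i) [0..<?K] = map (\<lambda>i. vs ! (\<sigma> \<circ> \<tau>) i) [0..<?K]"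
      proof (rule map_cong[OF refl])
        fix i assume "i \<in> set [0..<?K]"
        then have "\<tau> i < ?K"
          using permutes_in_image[of \<tau> "{..<?K}" i] \<tau> by auto
        then show "map (\<lambda>i. vs ! \<sigma> i) [0..<?K] ! \<tau> i = vs ! (\<sigma> \<circ> \<tau>) i"
          by (simp del: upt_Suc)
      qed
      \<comment> \<open>The inner permutation \<tau> fixes the last two positions, so it does not
        disturb the arguments of d\<lambda>.\<close>
      have 2: "map (\<lambda>i. vs ! \<sigma> i) [?K..<?M] = map (\<lambda>i. vs ! (\<sigma> \<circ> \<tau>) i) [?K..<?M]"
        using \<tau> permutes_not_in[of \<tau> "{..<?K}"] by (intro map_cong[OF refl]) auto
      have 3: "sign (\<sigma> \<circ> \<tau>) = sign \<sigma> * sign \<tau>"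
        using sign_compose_permutes[of "{..<?M}" \<sigma> \<tau>] \<sigma> QP[OF \<tau>] by simp
      show ?thesis
        unfolding \<Phi>_def 1 2 3 of_int_mult by (simp only: mult_ac)
    qed
    have "S ?K = (\<Sum>\<sigma>\<in>?P. \<Sum>\<tau>\<in>?Q. 1 / 2 ^ m * \<Phi> (\<sigma> \<circ> \<tau>))"
      unfolding S_def
    proof (rule sum.cong[OF refl])
      fix \<sigma> assume \<sigma>: "\<sigma> \<in> ?P"
      have "contact_power m q (map (\<lambda>i. vs ! \<sigma> i) [0..<?K])
          = 1 / 2 ^ m * (\<Sum>\<tau>\<in>?Q. of_int (sign \<tau>) * contact_product m q (map (\<lambda>i. map (\<lambda>i. vs ! \<sigma> i) [0..<?K] ! \<tau> i) [0..<?K]))"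
        unfolding Suc.IH antisymmetrization_def by (simp del: upt_Suc)
      then show "of_int (sign \<sigma>) * contact_power m q (map (\<lambda>i. vs ! \<sigma> i) [0..<?K])
          * ?\<eta> q (map (\<lambda>i. vs ! \<sigma> i) [?K..<?M]) = (\<Sum>\<tau>\<in>?Q. 1 / 2 ^ m * \<Phi> (\<sigma> \<circ> \<tau>))"
        using summand[OF \<sigma>, symmetric] by (simp add: sum_distrib_left sum_distrib_right mult_ac del: upt_Suc)
    qed
    also have "\<dots> = (\<Sum>\<tau>\<in>?Q. \<Sum>\<sigma>\<in>?P. 1 / 2 ^ m * \<Phi> (\<sigma> \<circ> \<tau>))"
      by (rule sum.swap)
    \<comment> \<open>For fixed \<tau>, the map \<sigma> to \<sigma> \<circ> \<tau> permutes the
      outer index set, so all K! inner sums are equal.\<close>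
    also have "\<dots> = (\<Sum>\<tau>\<in>?Q. 1 / 2 ^ m * sum \<Phi> ?P)"
    proof (rule sum.cong[OF refl])
      fix \<tau> assume "\<tau> \<in> ?Q"
      then have "sum \<Phi> ?P = (\<Sum>\<sigma>\<in>?P. \<Phi> (\<sigma> \<circ> \<tau>))"
        by (rule sum_permutations_compose_right[OF QP])
      then show "(\<Sum>\<sigma>\<in>?P. 1 / 2 ^ m * \<Phi> (\<sigma> \<circ> \<tau>)) = 1 / 2 ^ m * sum \<Phi> ?P"
        by (simp add: sum_distrib_left)
    qed
    also have "\<dots> = c * (1 / 2 ^ m * sum \<Phi> ?P)"
      by (simp only: sum_constant card_permutations[OF card_lessThan finite_lessThan] c_def of_nat_fact)
    finally have SK: "S ?K = c * (1 / 2 ^ m * sum \<Phi> ?P)" .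
    have M: "?M = 2 * m + 3"
      using True by simp
    have fact2: "fact (?M - ?K) = (2 :: real)"
      using True by simp
    have "(\<Sum>k\<le>?M. S k / (fact k * fact (?M - k))) = (\<Sum>k\<in>{?K}. S k / (fact k * fact (?M - k)))"
      by (rule sum.mono_neutral_right) (use True S0 in auto)
    also have "\<dots> = S ?K / (c * 2)"
      using fact2 by (simp add: c_def del: fact_Suc)
    also have "\<dots> = 1 / 2 ^ Suc m * sum \<Phi> ?P"
      unfolding SK using \<open>c \<noteq> 0\<close> by simp
    finally have "contact_power (Suc m) q vs = 1 / 2 ^ Suc m * sum \<Phi> ?P"
      unfolding wedge .
    moreover have "\<Phi> \<rho> = of_int (sign \<rho>) * contact_product (Suc m) q (map (\<lambda>i. vs ! \<rho> i) [0..<?M])" for \<rho>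
      by (simp only: \<Phi>_def M contact_product_Suc_permuted)
    moreover have "?M = 2 * Suc m + 1" using True by simp
    ultimately show ?thesis
      by (simp add: antisymmetrization_def del: upt_Suc)
  qed
qed

lemma linear_prod_one_factor:
  fixes f :: "'i \<Rightarrow> 'a::real_vector \<Rightarrow> real"
  assumes "finite J" "j \<in> J" "linear (f j)" "\<And>l u. l \<in> J \<Longrightarrow> l \<noteq> j \<Longrightarrow> f l u = g l"
  shows "linear (\<lambda>u. \<Prod>l\<in>J. f l u)"
proof -
  have "(\<Prod>l\<in>J. f l u) = (\<Prod>l\<in>J - {j}. g l) * f j u" for u
  proof -
    have "(\<Prod>l\<in>J. f l u) = f j u * (\<Prod>l\<in>J - {j}. f l u)"
      by (rule prod.remove[OF assms(1,2)])
    also have "(\<Prod>l\<in>J - {j}. f l u) = (\<Prod>l\<in>J - {j}. g l)"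
      by (rule prod.cong) (use assms(4) in auto)
    finally show ?thesis by simp
  qed
  then show ?thesis
    using linear_compose_scale_right[OF assms(3), of "\<Prod>l\<in>J - {j}. g l"] by simp
qed

lemma multilinear_contact_product: "multilinear_on_lists (2 * m + 1) (contact_product m q)"
  unfolding multilinear_on_lists_def
proof (intro allI impI; elim conjE)
  fix vs :: "'a phase list" and i
  assume vs: "length vs = 2 * m + 1" "i < 2 * m + 1"
  let ?f = "\<lambda>j u. symplectic (vs[i := u] ! (2 * j + 1)) (vs[i := u] ! (2 * j + 2))"
  show "linear (\<lambda>u. contact_product m q (vs[i := u]))"
  proof (cases "i = 0")
    case True
    have "contact_product m q (vs[i := u])
        = (\<Prod>j<m. symplectic (vs ! (2 * j + 1)) (vs ! (2 * j + 2))) * contact_covector q u" for u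
      using True vs by (simp add: contact_product_def mult.commute)
    then show ?thesis
      using linear_compose_scale_right[OF linear_contact_covector[of q]] by simp
  next
    case False
    define j where "j = (i - 1) div 2"
    have j: "j < m" "i = 2 * j + 1 \<or> i = 2 * j + 2"
      using vs(2) False unfolding j_def by auto
    have "linear (?f j)"
      using j(2)
    proof
      assume i: "i = 2 * j + 1"
      have "?f j = (\<lambda>u. symplectic u (vs ! (2 * j + 2)))"
        using vs by (simp add: i)
      then show ?thesis using linear_symplectic_left by simp
    next
      assume i: "i = 2 * j + 2"
      have "?f j = symplectic (vs ! (2 * j + 1))"
        using vs by (simp add: i fun_eq_iff)
      then show ?thesis using linear_symplectic_right by simp
    qed
    then have "linear (\<lambda>u. \<Prod>j<m. ?f j u)"
    proof (rule linear_prod_one_factor[rotated 2])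
      fix l u assume "l \<noteq> j"
      then have "i \<noteq> 2 * l + 1" "i \<noteq> 2 * l + 2"
        using j by presburger+
      then show "?f l u = symplectic (vs ! (2 * l + 1)) (vs ! (2 * l + 2))"
        by simp
    qed (use j in auto)
    then show ?thesis
      using linear_compose_scale_right[of "\<lambda>u. \<Prod>j<m. ?f j u" "contact_covector q (vs ! 0)"] False
      by (simp add: contact_product_def)
  qed
qed

lemma alternating_contact_power: "alternating (2 * m + 1) (contact_power m q)"
  unfolding contact_power_eq[abs_def]
  by (intro alternating_scale alternating_antisymmetrization multilinear_contact_product)

text \<open>
  The contact forms at two points are related by a unimodular shear along the Reeb direction, which
  is why the standard volume has constant coefficients.
\<close>

definition contact_shear :: "('n::finite) phase \<Rightarrow> 'n phase \<Rightarrow> 'n phase" where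
  "contact_shear q u = u + (contact_covector 0 u - contact_covector q u) *\<^sub>R (0, 0, 0, 0, 1)"

lemma contact_covector_shear: "contact_covector q (contact_shear q u) = contact_covector 0 u"
  by (simp add: contact_shear_def linear_add[OF linear_contact_covector]
      linear_cmul[OF linear_contact_covector]) (simp add: contact_covector_def split: prod.splits)

lemma symplectic_shear: "symplectic (contact_shear q u) (contact_shear q v) = symplectic u v"
  by (simp add: contact_shear_def symplectic_def split: prod.splits)

text \<open>The shear fixes z, and once z is an argument, added multiples of z are invisible to A.
  Hence A and its pullback agree on a basis list starting with z, and so everywhere.\<close>

lemma alternating_shear:
  fixes A :: "'a::euclidean_space list \<Rightarrow> real"
  assumes A: "alternating DIM('a) A" and z: "z \<in> Basis" and c: "linear c" "c z = 0"
  shows "A (map (\<lambda>u. u + c u *\<^sub>R z) us) = A us"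
proof -
  let ?T = "\<lambda>u. u + c u *\<^sub>R z"
  have T: "linear ?T"
    by (intro linear_compose_add linear_ident linear_compose[OF c(1), unfolded o_def]) (simp add: linearI scaleR_add_left)
  have shear: "A (z # ws @ map ?T us) = A (z # ws @ us)" if "length (z # ws @ us) = DIM('a)" for ws us
    using that
  proof (induction us arbitrary: ws)
    case (Cons u us)
    let ?vs = "z # ws @ u # us"
    have lin: "linear (\<lambda>v. A (z # ws @ v # us))"
      using alternating_linear[OF A, of ?vs "Suc (length ws)"] Cons.prems by (simp add: list_update_append)
    have "A (z # ws @ z # us) = 0"
      by (rule alternating_repeated[OF A, of _ 0 "Suc (length ws)"]) (use Cons.prems in auto)
    then have "A (z # ws @ ?T u # us) = A (z # ws @ u # us)"
      by (simp add: linear_add[OF lin] linear_cmul[OF lin])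
    then show ?case
      using Cons.IH[of "ws @ [?T u]"] Cons.prems by simp
  qed simp
  obtain bs where bs: "set bs = Basis - {z}" "distinct bs"
    using finite_distinct_list[of "Basis - {z}"] by auto
  have len: "length (z # bs) = DIM('a)"
    using distinct_card[OF bs(2)] bs(1) z card_Suc_Diff1[OF finite_Basis z] by simp
  have "A (map ?T (z # bs)) = A (z # bs)"
    using shear[of "[]" bs] len c by simp
  then have "A (map ?T us) - A us = 0"
    using alternating_eq_0[OF alternating_diff[OF alternating_map[OF A T] A], of "z # bs"] bs z len by auto
  then show ?thesis by simp
qed

section \<open>The standard volume is constant and nowhere zero\<close>

lemma DIM_phase: "DIM(('n::finite) phase) = 2 * (CARD('n) + 1) + 1"
  by simp

lemma alternating_standard_volume:
  "alternating DIM(('n::finite) phase) (standard_volume (q :: 'n phase))"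
  unfolding standard_volume_eq DIM_phase by (rule alternating_contact_power)

lemma standard_volume_constant:
  "standard_volume (q :: ('n::finite) phase) = standard_volume 0"
proof
  fix vs :: "'n phase list"
  let ?m = "CARD('n) + 1"
  have "contact_product ?m q (map (\<lambda>i. map (contact_shear q) vs ! \<sigma> i) [0..<2 * ?m + 1])
      = contact_product ?m 0 (map (\<lambda>i. vs ! \<sigma> i) [0..<2 * ?m + 1])"
    if "\<sigma> permutes {..<2 * ?m + 1}" "length vs = 2 * ?m + 1" for \<sigma>
  proof -
    have "map (\<lambda>i. map (contact_shear q) vs ! \<sigma> i) [0..<2 * ?m + 1]
        = map (contact_shear q) (map (\<lambda>i. vs ! \<sigma> i) [0..<2 * ?m + 1])"
      unfolding map_map
    proof (rule map_cong[OF refl])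
      fix i assume "i \<in> set [0..<2 * ?m + 1]"
      then have "\<sigma> i < length vs"
        using permutes_in_image[OF that(1), of i] that(2) by (simp only: set_upt lessThan_iff atLeastLessThan_iff)
      then show "map (contact_shear q) vs ! \<sigma> i = (contact_shear q \<circ> (\<lambda>i. vs ! \<sigma> i)) i"
        by simp
    qed
    moreover have "contact_product m q (map (contact_shear q) ws) = contact_product m 0 ws"
      if "length ws = 2 * m + 1" for m ws
      using that by (simp add: contact_product_def contact_covector_shear symplectic_shear)
    ultimately show ?thesis by (simp only: length_map length_upt diff_zero)
  qed
  \<comment> \<open>The shear pulls the contact form at q back to the one at 0 and preserves
    d\<lambda>, hence relates the two volume forms; by unimodularity it also leaves the form at q
    unchanged.\<close>
  then have "standard_volume q (map (contact_shear q) vs) = standard_volume 0 vs"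
    unfolding standard_volume_eq contact_power_eq antisymmetrization_def
    by (auto intro!: sum.cong simp del: upt_Suc)
  moreover have "standard_volume q (map (contact_shear q) vs) = standard_volume q vs"
    unfolding contact_shear_def[abs_def]
  proof (rule alternating_shear[OF alternating_standard_volume])
    show "(0, 0, 0, 0, 1) \<in> (Basis :: 'n phase set)"
      by (simp add: Basis_prod_def)
    show "linear (\<lambda>u. contact_covector 0 u - contact_covector q u)"
      by (intro linear_compose_sub linear_contact_covector)
  qed (simp add: contact_covector_def split: prod.splits)
  ultimately show "standard_volume q vs = standard_volume 0 vs" by simp
qed

text \<open>On the Darboux basis b the value is a positive multiple of the sum of all
  \<open>pairing_term\<close>s, which is positive.\<close>

lemma standard_volume_nonzero: "\<exists>vs. standard_volume (q :: ('n::finite) phase) vs \<noteq> 0"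
proof -
  let ?n = "CARD('n)" and ?m = "CARD('n) + 1"
  obtain \<iota> :: "nat \<Rightarrow> 'n" where \<iota>: "bij_betw \<iota> {0..<?n} UNIV"
    using ex_bij_betw_nat_finite[of "UNIV :: 'n set"] by auto
  have \<iota>_eq: "\<iota> i = \<iota> j \<longleftrightarrow> i = j" if "i < ?n" "j < ?n" for i j
    using \<iota> that by (auto simp: bij_betw_def inj_on_def)
  \<comment> \<open>Indices below n enumerate the conjugate pairs of x and p; the index n stands for
    the additional pair of y and w.\<close>
  define e where "e j = (if j < ?n then (axis (\<iota> j) 1, 0, 0, 0, 0) else (0, 1, 0, 0, 0) :: 'n phase)" for j
  define f where "f j = (if j < ?n then (0, 0, axis (\<iota> j) 1, 0, 0) else (0, 0, 0, 1, 0) :: 'n phase)" for j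
  \<comment> \<open>The subtraction of 1 in the even case puts \<open>e j\<close> at 2j + 1 and
    \<open>f j\<close> at 2j + 2, in line with \<open>pairing\<close>.\<close>
  define b where "b i = (if i = 0 then (0, 0, 0, 0, 1) else if odd i then e (i div 2) else f (i div 2 - 1))" for i
  have ef: "symplectic (e i) (f j) = (if i = j then 1 else 0)"
      "symplectic (e i) (e j) = 0" "symplectic (f i) (f j) = 0" if "i \<le> ?n" "j \<le> ?n" for i j
    using that by (auto simp: e_def f_def symplectic_def inner_axis_axis \<iota>_eq)
  have cov: "contact_covector 0 (b i) = (if i = 0 then 1 else 0)" for i
    by (auto simp: b_def e_def f_def contact_covector_def zero_prod_def)
  have pair: "symplectic (b i) (b j) = pairing i j" if "i < 2 * ?m + 1" "j < 2 * ?m + 1" "i \<noteq> 0" "j \<noteq> 0" for i j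
  proof -
    have bb: "b i = (if odd i then e (i div 2) else f (i div 2 - 1))" "b j = (if odd j then e (j div 2) else f (j div 2 - 1))"
      using that by (simp_all add: b_def)
    have le: "odd k \<Longrightarrow> k div 2 \<le> ?n" "i div 2 - 1 \<le> ?n" "j div 2 - 1 \<le> ?n"
      if "k < 2 * ?m + 1" for k
      using that \<open>i < 2 * ?m + 1\<close> \<open>j < 2 * ?m + 1\<close> by presburger+
    note le = le(1)[OF that(1)] le(1)[OF that(2)] le(2,3)[OF that(1)]
    show ?thesis
    proof (cases "odd i"; cases "odd j")
      assume "odd i" "odd j"
      then show ?thesis
        using ef(2)[of "i div 2" "j div 2"] le by (auto simp: bb pairing_def)
    next
      assume "odd i" "\<not> odd j"
      then have "i div 2 = j div 2 - 1 \<longleftrightarrow> j = Suc i"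
        using that by presburger
      then show ?thesis
        using ef(1)[of "i div 2" "j div 2 - 1"] le \<open>odd i\<close> \<open>\<not> odd j\<close> by (simp add: bb pairing_def)
    next
      assume "\<not> odd i" "odd j"
      then have "j div 2 = i div 2 - 1 \<longleftrightarrow> i = Suc j"
        using that by presburger
      then show ?thesis
        using ef(1)[of "j div 2" "i div 2 - 1"] le \<open>odd j\<close> \<open>\<not> odd i\<close>
        by (simp add: bb pairing_def symplectic_antisym[of "f _"])
    next
      assume "\<not> odd i" "\<not> odd j"
      then show ?thesis
        using ef(3)[of "i div 2 - 1" "j div 2 - 1"] le by (auto simp: bb pairing_def)
    qed
  qed
  define vs where "vs = map b [0..<2 * ?m + 1]"
  have "of_int (sign \<sigma>) * contact_product ?m 0 (map (\<lambda>i. vs ! \<sigma> i) [0..<2 * ?m + 1]) = pairing_term ?m \<sigma>"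
    if \<sigma>: "\<sigma> permutes {..<2 * ?m + 1}" for \<sigma>
  proof -
    have bound: "\<sigma> i < 2 * ?m + 1" if "i < 2 * ?m + 1" for i
      using permutes_in_image[OF \<sigma>, of i] that by simp
    have vs: "map (\<lambda>i. vs ! \<sigma> i) [0..<2 * ?m + 1] ! i = b (\<sigma> i)" if "i < 2 * ?m + 1" for i
      using that bound[OF that] by (simp add: vs_def del: upt_Suc)
    let ?L = "map (\<lambda>i. vs ! \<sigma> i) [0..<2 * ?m + 1]"
    have "?L ! 0 = b (\<sigma> 0)"
      by (rule vs) simp
    moreover have "(\<Prod>j<?m. symplectic (?L ! (2 * j + 1)) (?L ! (2 * j + 2)))
        = (\<Prod>j<?m. symplectic (b (\<sigma> (2 * j + 1))) (b (\<sigma> (2 * j + 2))))"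
    proof (rule prod.cong[OF refl])
      fix j assume "j \<in> {..<?m}"
      then have "2 * j + 1 < 2 * ?m + 1" "2 * j + 2 < 2 * ?m + 1" by auto
      then show "symplectic (?L ! (2 * j + 1)) (?L ! (2 * j + 2))
          = symplectic (b (\<sigma> (2 * j + 1))) (b (\<sigma> (2 * j + 2)))"
        by (simp only: vs)
    qed
    ultimately have product: "contact_product ?m 0 ?L = (if \<sigma> 0 = 0 then 1 else 0)
        * (\<Prod>j<?m. symplectic (b (\<sigma> (2 * j + 1))) (b (\<sigma> (2 * j + 2))))"
      by (simp only: contact_product_def cov)
    show ?thesis
    proof (cases "\<sigma> 0 = 0")
      case True
      have nz: "\<sigma> i \<noteq> 0" if "i \<noteq> 0" for i
        using True that permutes_inj[OF \<sigma>] by (metis injD)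
      have "(\<Prod>j<?m. symplectic (b (\<sigma> (2 * j + 1))) (b (\<sigma> (2 * j + 2))))
          = (\<Prod>j<?m. pairing (\<sigma> (2 * j + 1)) (\<sigma> (2 * j + 2)))"
        by (intro prod.cong refl pair bound nz) auto
      then show ?thesis
        by (simp only: product pairing_term_def)
    next
      case False
      then show ?thesis
        unfolding product pairing_term_def by simp
    qed
  qed
  then have "standard_volume 0 vs = 1 / 2 ^ ?m * (\<Sum>\<sigma> | \<sigma> permutes {..<2 * ?m + 1}. pairing_term ?m \<sigma>)"
    unfolding standard_volume_eq contact_power_eq antisymmetrization_def
    by (simp add: vs_def del: upt_Suc)
  then have "standard_volume q vs > 0"
    using sum_pairing_term_pos[of ?m] by (simp add: standard_volume_constant[of q])
  then show ?thesis by (metis less_irrefl)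
qed

section \<open>The Lie derivative of a density\<close>

lemma alternating_Cons_linear:
  assumes "alternating k A" "length us = k - 1" "0 < k"
  shows "linear (\<lambda>u. A (u # us))"
  using alternating_linear[OF assms(1), of "0 # us" 0] assms by simp

text \<open>Both halves of the Cartan formula produce the sum of the terms in which a vector of
  \<open>vs\<close> differentiates f, with opposite signs. What remains is X f from the first half
  and the derivative of X, acting slot by slot, from the second.\<close>

lemma lie_derivative_density:
  fixes X :: "'a::euclidean_space \<Rightarrow> 'a"
  assumes D: "alternating DIM('a) D" and f: "f differentiable (at q)" and X: "(X has_derivative X') (at q)"
  shows "lie_derivative X (\<lambda>q vs. f q * D vs) q vs
    = (frechet_derivative f (at q) (X q) + f q * (\<Sum>b\<in>Basis. X' b \<bullet> b)) * D vs"
proof (cases "length vs = DIM('a)")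
  case False
  have "D (X y # take i vs @ drop (Suc i) vs) = 0" if "i < length vs" for i y
    by (rule alternating_length[OF D]) (use that False in auto)
  moreover have "D (take i (X q # vs) @ drop (Suc i) (X q # vs)) = 0" if "i < length (X q # vs)" for i
    by (rule alternating_length[OF D]) (use that False in auto)
  ultimately show ?thesis
    using alternating_length[OF D False]
    by (simp add: lie_derivative_def iprod_def ext_d_def del: sum.lessThan_Suc)
next
  case True
  let ?f' = "frechet_derivative f (at q)"
  let ?w = "\<lambda>i. take i vs @ drop (Suc i) vs"
  have f': "(f has_derivative ?f') (at q)"
    by (rule iffD1[OF frechet_derivative_works f])
  have X'lin: "linear X'"
    using X has_derivative_linear by blast
  have "frechet_derivative (\<lambda>y. f y * D us) (at q) = (\<lambda>v. ?f' v * D us)" for us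
    by (rule frechet_derivative_at[symmetric]) (rule has_derivative_mult_left[OF f'])
  then have "iprod X (ext_d (\<lambda>q vs. f q * D vs)) q vs
      = (\<Sum>i<Suc (length vs). (- 1) ^ i * (?f' ((X q # vs) ! i) * D (take i (X q # vs) @ drop (Suc i) (X q # vs))))"
    by (simp add: iprod_def ext_d_def del: sum.lessThan_Suc)
  \<comment> \<open>The term differentiating along X itself is split off; the others get one more
    sign because X stands in front.\<close>
  also have "\<dots> = ?f' (X q) * D vs + (\<Sum>i<length vs. (- 1) ^ Suc i * (?f' (vs ! i) * D (X q # ?w i)))"
    by (subst sum.lessThan_Suc_shift) simp
  finally have 1: "iprod X (ext_d (\<lambda>q vs. f q * D vs)) q vs
      = ?f' (X q) * D vs - (\<Sum>i<length vs. (- 1) ^ i * (?f' (vs ! i) * D (X q # ?w i)))"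
    by (simp add: sum_negf)
  have "frechet_derivative (\<lambda>y. f y * D (X y # ?w i)) (at q)
      = (\<lambda>v. f q * D (X' v # ?w i) + ?f' v * D (X q # ?w i))" if i: "i < length vs" for i
  proof (rule frechet_derivative_at[symmetric])
    have "linear (\<lambda>u. D (u # ?w i))"
      by (rule alternating_Cons_linear[OF D]) (use i True in auto)
    then have "((\<lambda>y. D (X y # ?w i)) has_derivative (\<lambda>v. D (X' v # ?w i))) (at q)"
      by (intro bounded_linear.has_derivative[OF _ X] linear_conv_bounded_linear[THEN iffD1])
    then show "((\<lambda>y. f y * D (X y # ?w i)) has_derivative
        (\<lambda>v. f q * D (X' v # ?w i) + ?f' v * D (X q # ?w i))) (at q)"
      by (rule has_derivative_mult[OF f'])
  qed
  then have "ext_d (iprod X (\<lambda>q vs. f q * D vs)) q vs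
      = (\<Sum>i<length vs. (- 1) ^ i * (f q * D (X' (vs ! i) # ?w i) + ?f' (vs ! i) * D (X q # ?w i)))"
    by (simp add: iprod_def ext_d_def)
  also have "\<dots> = f q * (\<Sum>i<length vs. (- 1) ^ i * D (X' (vs ! i) # ?w i))
      + (\<Sum>i<length vs. (- 1) ^ i * (?f' (vs ! i) * D (X q # ?w i)))"
    by (simp add: sum.distrib[symmetric] sum_distrib_left algebra_simps)
  also have "(\<Sum>i<length vs. (- 1) ^ i * D (X' (vs ! i) # ?w i)) = (\<Sum>i<length vs. D (vs[i := X' (vs ! i)]))"
  proof (rule sum.cong[OF refl])
    fix i assume "i \<in> {..<length vs}"
    then have i: "i < length vs" by simp
    have "D ([] @ X' (vs ! i) # take i vs @ drop (Suc i) vs)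
        = (- 1) ^ length (take i vs) * D ([] @ take i vs @ X' (vs ! i) # drop (Suc i) vs)"
      by (rule alternating_move[OF D]) (use i True in auto)
    then have "D (X' (vs ! i) # ?w i) = (- 1) ^ i * D (vs[i := X' (vs ! i)])"
      using i by (simp add: upd_conv_take_nth_drop)
    then show "(- 1) ^ i * D (X' (vs ! i) # ?w i) = D (vs[i := X' (vs ! i)])"
      by (simp add: mult.assoc[symmetric] power_mult_distrib[symmetric])
  qed
  also have "\<dots> = (\<Sum>b\<in>Basis. X' b \<bullet> b) * D vs"
    using alternating_trace[OF D X'lin True] True by simp
  finally show ?thesis
    using 1 by (simp add: lie_derivative_def algebra_simps)
qed

lemma differential_form_density:
  fixes S :: "'a::euclidean_space set"
  assumes "open S" "smooth_on S f" and D: "alternating k D"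
  shows "differential_form k S (\<lambda>q vs. f q * D vs)"
proof -
  have "smooth_on S (\<lambda>q. f q * D vs)" for vs
    using smooth_on_mult[OF assms(1,2) smooth_on_const[OF assms(1)]] .
  moreover have "linear (\<lambda>u. f q * D (vs[i := u]))" if "length vs = k" "i < k" for q vs i
    using linear_compose_scale_right[OF alternating_linear[OF D that], of "f q"] by simp
  moreover have "D vs = 0" if "length vs = k" "i < j" "j < k" "vs ! i = vs ! j" for vs i j
    by (rule alternating_repeated[OF D, of _ i j]) (use that in auto)
  ultimately show ?thesis
    unfolding differential_form_def using alternating_length[OF D] by (simp, blast)
qed

text \<open>As D is a fixed nonzero form, each clause can be tested on one list \<open>us\<close>
  and divided by \<open>D us\<close>. Both directions matter: one verifies the given density, the
  other turns an arbitrary invariant density into a transport equation.\<close>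

lemma invariant_measure_density_iff:
  fixes X :: "'a::euclidean_space \<Rightarrow> 'a"
  assumes S: "open S" and D: "alternating DIM('a) D" "\<exists>vs. D vs \<noteq> 0"
    and X: "\<forall>q\<in>S. (X has_derivative X' q) (at q)"
    and div: "\<forall>q\<in>S. (\<Sum>b\<in>Basis. X' q b \<bullet> b) = d"
  shows "invariant_measure S X (\<lambda>t q vs. f t q * D vs) \<longleftrightarrow>
    (\<forall>t. smooth_on S (f t)) \<and> (\<forall>t. \<forall>q\<in>S. f t q \<noteq> 0) \<and>
    (\<forall>t. \<forall>q\<in>S. ((\<lambda>s. f s q) has_real_derivative 0) (at t)) \<and>
    (\<forall>t. \<forall>q\<in>S. frechet_derivative (f t) (at q) (X q) + f t q * d = 0)"
    (is "?L \<longleftrightarrow> ?R1 \<and> ?R2 \<and> ?R3 \<and> ?R4")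
proof -
  obtain us where us: "D us \<noteq> 0" using D(2) by blast
  have sm: "(\<forall>t. differential_form DIM('a) S (\<lambda>q vs. f t q * D vs)) \<longleftrightarrow> ?R1"
  proof (intro iffI allI)
    fix t assume "\<forall>t. differential_form DIM('a) S (\<lambda>q vs. f t q * D vs)"
    then have "smooth_on S (\<lambda>q. f t q * D us)"
      unfolding differential_form_def by blast
    then have "smooth_on S (\<lambda>q. f t q * D us / D us)"
      by (rule smooth_on_divide_const[OF S])
    then show "smooth_on S (f t)"
      using us by simp
  qed (use differential_form_density[OF S _ D(1)] in blast)
  have der: "(\<forall>vs. ((\<lambda>s. f s q * D vs) has_real_derivative 0) (at t)) \<longleftrightarrow>
      ((\<lambda>s. f s q) has_real_derivative 0) (at t)" for t q
  proof
    assume "\<forall>vs. ((\<lambda>s. f s q * D vs) has_real_derivative 0) (at t)"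
    then have "((\<lambda>s. f s q * D us) has_real_derivative 0) (at t)" by blast
    from DERIV_cdivide[OF this, of "D us"] show "((\<lambda>s. f s q) has_real_derivative 0) (at t)"
      using us by simp
  next
    assume "((\<lambda>s. f s q) has_real_derivative 0) (at t)"
    from DERIV_cmult_right[OF this] show "\<forall>vs. ((\<lambda>s. f s q * D vs) has_real_derivative 0) (at t)"
      by simp
  qed
  have lie: "(\<forall>vs. lie_derivative X (\<lambda>q vs. f t q * D vs) q vs = 0) \<longleftrightarrow>
      frechet_derivative (f t) (at q) (X q) + f t q * d = 0" if "q \<in> S" "f t differentiable (at q)" for t q
    unfolding lie_derivative_density[OF D(1) that(2) bspec[OF X that(1)]] bspec[OF div that(1)]
    using us by auto
  have "?L \<longleftrightarrow> ?R1 \<and> (\<forall>t. \<forall>q\<in>S. \<exists>vs. f t q * D vs \<noteq> 0) \<and>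
      (\<forall>t. \<forall>q\<in>S. \<forall>vs. ((\<lambda>s. f s q * D vs) has_real_derivative 0) (at t)) \<and>
      (\<forall>t. \<forall>q\<in>S. \<forall>vs. lie_derivative X (\<lambda>q vs. f t q * D vs) q vs = 0)"
    unfolding invariant_measure_def sm ..
  moreover have "(\<forall>t. \<forall>q\<in>S. \<exists>vs. f t q * D vs \<noteq> 0) \<longleftrightarrow> ?R2"
    using us by auto
  moreover have "?R1 \<Longrightarrow> (\<forall>t. \<forall>q\<in>S. \<forall>vs. lie_derivative X (\<lambda>q vs. f t q * D vs) q vs = 0) \<longleftrightarrow> ?R4"
    using lie smooth_on_differentiable by blast
  ultimately show ?thesis
    unfolding der by blast
qed

section \<open>Hamiltonians affine in the momenta and the contact coordinate\<close>

lemma sum_Basis_prod: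
  fixes f :: "'a::euclidean_space \<times> 'b::euclidean_space \<Rightarrow> real"
  shows "sum f Basis = (\<Sum>i\<in>Basis. f (i, 0)) + (\<Sum>i\<in>Basis. f (0, i))"
proof -
  have "inj_on (\<lambda>u. (u::'a, 0::'b)) Basis" "inj_on (\<lambda>u. (0::'a, u::'b)) Basis"
    by (auto intro!: inj_onI Pair_inject)
  then show ?thesis
    unfolding Basis_prod_def
    by (subst sum.union_disjoint) (auto simp: sum.reindex)
qed

lemma sum_Basis_vec:
  fixes f :: "real ^ 'n \<Rightarrow> real"
  shows "sum f Basis = (\<Sum>a\<in>UNIV. f (axis a 1))"
proof -
  have "(Basis :: (real ^ 'n) set) = range (\<lambda>a. axis a 1)"
    by (auto simp: Basis_vec_def)
  then have "sum f Basis = sum f (range (\<lambda>a. axis a 1))"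
    by (rule arg_cong)
  moreover have "inj (\<lambda>a. axis a (1 :: real) :: real ^ 'n)"
    by (auto simp: inj_def axis_eq_axis)
  ultimately show ?thesis
    using sum.reindex by fastforce
qed

lemma axis_1_nth: "axis a (1 :: real) $ b = (if b = a then 1 else 0)"
  by (simp add: axis_def)

lemma has_derivative_vec_lambda:
  fixes f :: "'n::finite \<Rightarrow> 'a::real_normed_vector \<Rightarrow> real"
  assumes "\<And>a. (f a has_derivative f' a) (at x)"
  shows "((\<lambda>x. \<chi> a. f a x) has_derivative (\<lambda>v. \<chi> a. f' a v)) (at x)"
proof -
  have *: "(\<chi> a. g a) = (\<Sum>a\<in>UNIV. g a *\<^sub>R axis a 1)" for g :: "'n \<Rightarrow> real"
    by (simp add: vec_eq_iff axis_def if_distrib cong: if_cong)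
  show ?thesis
    unfolding * by (intro has_derivative_sum has_derivative_scaleR_left assms)
qed

text \<open>Isolates the structure that makes the divergence constant: coefficients depending on x
  only, and constant slopes in y and z.\<close>

definition affine_hamiltonian ::
    "(real^'n \<Rightarrow> real) \<Rightarrow> (real^'n \<Rightarrow> real) \<Rightarrow> ('n \<Rightarrow> real^'n \<Rightarrow> real) \<Rightarrow> real \<Rightarrow> real
      \<Rightarrow> ('n::finite) phase \<Rightarrow> real" where
  "affine_hamiltonian A B F c g = (\<lambda>(x, y, p, w, z).
     A x + w * B x - (\<Sum>a\<in>UNIV. p $ a * F a x) + c * y - g * z)"

lemma contact_hamiltonian_affine:
  "contact_hamiltonian \<psi> F p0 \<gamma>0 = affine_hamiltonian (\<lambda>x. \<gamma>0 * \<psi> x)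
     (\<lambda>x. \<Sum>a\<in>UNIV. frechet_derivative \<psi> (at x) (axis a 1) / p0 * F a x) F (\<gamma>0 * p0) \<gamma>0"
  by (auto simp: fun_eq_iff contact_hamiltonian_def affine_hamiltonian_def sum_distrib_left
      sum_subtractf algebra_simps)

text \<open>The coordinate equations of the contact Hamiltonian field for this Hamiltonian. The
  momenta drop out of the z-component, since subtracting p dh/dp and w dh/dw removes the terms
  linear in them.\<close>

definition affine_contact_field ::
    "(real^'n \<Rightarrow> real) \<Rightarrow> (real^'n \<Rightarrow> real) \<Rightarrow> ('n \<Rightarrow> real^'n \<Rightarrow> real) \<Rightarrow> real \<Rightarrow> real
      \<Rightarrow> ('n::finite) phase \<Rightarrow> 'n phase" where
  "affine_contact_field A B F c g = (\<lambda>(x, y, p, w, z).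
     (\<chi> a. F a x, - B x,
      \<chi> b. frechet_derivative A (at x) (axis b 1) + w * frechet_derivative B (at x) (axis b 1)
        - (\<Sum>a\<in>UNIV. p $ a * frechet_derivative (F a) (at x) (axis b 1)) - g * p $ b,
      c - g * w, A x + c * y - g * z))"

lemma has_derivative_affine_hamiltonian:
  assumes "A differentiable (at x)" "B differentiable (at x)" "\<And>a. F a differentiable (at x)"
  shows "(affine_hamiltonian A B F c g has_derivative (\<lambda>(x', y', p', w', z').
      frechet_derivative A (at x) x' + (w * frechet_derivative B (at x) x' + w' * B x)
      - (\<Sum>a\<in>UNIV. p $ a * frechet_derivative (F a) (at x) x' + p' $ a * F a x) + c * y' - g * z'))
    (at (x, y, p, w, z))"
proof -
  let ?q = "(x, y, p, w, z)"
  let ?p = "\<lambda>q :: 'a phase. fst (snd (snd q))" and ?w = "\<lambda>q :: 'a phase. fst (snd (snd (snd q)))"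
  have fst: "((\<lambda>q. f (fst q)) has_derivative (\<lambda>v. frechet_derivative f (at x) (fst v))) (at ?q)"
    if "f differentiable (at x)" for f :: "real^'a \<Rightarrow> real"
    using has_derivative_comp_fst[of f ?q] that by simp
  have p: "((\<lambda>q. ?p q $ a) has_derivative (\<lambda>v. ?p v $ a)) (at ?q)" for a
    by (intro bounded_linear_imp_has_derivative bounded_linear_compose[OF bounded_linear_vec_nth]
        bounded_linear_compose[OF bounded_linear_fst] bounded_linear_compose[OF bounded_linear_snd] bounded_linear_snd)
  have w: "(?w has_derivative ?w) (at ?q)"
    by (intro bounded_linear_imp_has_derivative
        bounded_linear_compose[OF bounded_linear_fst] bounded_linear_compose[OF bounded_linear_snd] bounded_linear_snd)
  have yz: "((\<lambda>q :: 'a phase. fst (snd q)) has_derivative (\<lambda>q. fst (snd q))) (at ?q)"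
    "((\<lambda>q :: 'a phase. snd (snd (snd (snd q)))) has_derivative (\<lambda>q. snd (snd (snd (snd q))))) (at ?q)"
    by (intro bounded_linear_imp_has_derivative
        bounded_linear_compose[OF bounded_linear_fst] bounded_linear_compose[OF bounded_linear_snd] bounded_linear_snd)+
  have "((\<lambda>q :: 'a phase. A (fst q) + ?w q * B (fst q) - (\<Sum>a\<in>UNIV. ?p q $ a * F a (fst q))
      + c * fst (snd q) - g * snd (snd (snd (snd q)))) has_derivative
      (\<lambda>v. frechet_derivative A (at x) (fst v) + (?w ?q * frechet_derivative B (at x) (fst v) + ?w v * B (fst ?q))
       - (\<Sum>a\<in>UNIV. ?p ?q $ a * frechet_derivative (F a) (at x) (fst v) + ?p v $ a * F a (fst ?q))
       + c * fst (snd v) - g * snd (snd (snd (snd v))))) (at ?q)"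
    by (intro has_derivative_add has_derivative_diff has_derivative_sum has_derivative_mult
        has_derivative_mult_right fst p w yz assms)
  then show ?thesis
    by (simp add: affine_hamiltonian_def case_prod_unfold)
qed

lemma contact_form_singleton: "contact_form q [v] = contact_covector q v"
  by (simp add: contact_form_eq)

lemma contact_hamiltonian_vfD:
  assumes "contact_hamiltonian_vf R h X" "q \<in> R"
  shows "contact_covector q (X q) = h q"
    and "symplectic (X q) v
      = - (frechet_derivative h (at q) v - partial_z h q * contact_covector q v)"
proof -
  have "contact_form q [X q] = zero_form h q []"
    using assms unfolding contact_hamiltonian_vf_def iprod_def by blast
  then show "contact_covector q (X q) = h q"
    by (simp add: contact_form_singleton zero_form_def)
  have "ext_d contact_form q [X q, v]
      = - (ext_d (zero_form h) q [v] - partial_z h q * contact_form q [v])"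
    using assms unfolding contact_hamiltonian_vf_def iprod_def by blast
  then show "symplectic (X q) v
      = - (frechet_derivative h (at q) v - partial_z h q * contact_covector q v)"
    by (simp add: ext_d_contact_form contact_form_singleton)
      (simp add: ext_d_def zero_form_def)
qed

text \<open>Insert X into its own second equation: d\<lambda>(X, X) vanishes by antisymmetry, and
  \<lambda>(X) = h.\<close>

lemma contact_hamiltonian_vf_derivative_self:
  assumes "contact_hamiltonian_vf R h X" "q \<in> R"
  shows "frechet_derivative h (at q) (X q) = partial_z h q * h q"
  using contact_hamiltonian_vfD(1)[OF assms] contact_hamiltonian_vfD(2)[OF assms, of "X q"] symplectic_antisym[of "X q" "X q"]
  by (simp add: mult.commute)

context
  fixes A B :: "real^'n::finite \<Rightarrow> real" and F :: "'n \<Rightarrow> real^'n \<Rightarrow> real" and c g :: real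
    and T :: "(real^'n) set"
  assumes A: "smooth_on T A" and B: "smooth_on T B" and F: "\<And>a. smooth_on T (F a)"
begin

lemma frechet_derivative_affine_hamiltonian:
  assumes "x \<in> T"
  shows "frechet_derivative (affine_hamiltonian A B F c g) (at (x, y, p, w, z)) (x', y', p', w', z')
    = frechet_derivative A (at x) x' + (w * frechet_derivative B (at x) x' + w' * B x)
      - (\<Sum>a\<in>UNIV. p $ a * frechet_derivative (F a) (at x) x' + p' $ a * F a x) + c * y' - g * z'"
  using frechet_derivative_at[OF has_derivative_affine_hamiltonian[of A x B F c g w p y z,
        OF A[THEN smooth_on_differentiable] B[THEN smooth_on_differentiable] F[THEN smooth_on_differentiable],
        OF assms assms assms]]
  by (simp add: fun_eq_iff)

lemma partial_z_affine_hamiltonian: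
  assumes "fst q \<in> T"
  shows "partial_z (affine_hamiltonian A B F c g) q = - g"
proof -
  have "frechet_derivative f (at (fst q)) 0 = 0" if "smooth_on T f" for f
    by (rule linear_0[OF linear_frechet_derivative[OF smooth_on_differentiable[OF that assms]]])
  note zeros = this[OF A] this[OF B] this[OF F]
  obtain x y p w z where q: "q = (x, y, p, w, z)" by (metis prod_cases5)
  then show ?thesis
    using assms zeros by (simp add: partial_z_def frechet_derivative_affine_hamiltonian)
qed

text \<open>Pairing with a coordinate direction under d\<lambda> reads off the conjugate component
  of X; only the Reeb component is invisible to d\<lambda>, and it follows from \<lambda>(X) =
  h.\<close>

lemma affine_contact_field_unique:
  assumes X: "contact_hamiltonian_vf R (affine_hamiltonian A B F c g) X" and q: "q \<in> R" "fst q \<in> T"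
  shows "X q = affine_contact_field A B F c g q"
proof -
  obtain x y p w z where q_eq: "q = (x, y, p, w, z)" by (metis prod_cases5)
  obtain x' y' p' w' z' where X_eq: "X q = (x', y', p', w', z')" by (metis prod_cases5)
  have x: "x \<in> T" using q q_eq by simp
  have zero: "frechet_derivative f (at x) 0 = 0" if "smooth_on T f" for f
    by (rule linear_0[OF linear_frechet_derivative[OF smooth_on_differentiable[OF that x]]])
  have symp: "symplectic (x', y', p', w', z') (x1, y1, p1, w1, z1)
      = - (frechet_derivative A (at x) x1 + (w * frechet_derivative B (at x) x1 + w1 * B x)
      - (\<Sum>a\<in>UNIV. p $ a * frechet_derivative (F a) (at x) x1 + p1 $ a * F a x) + c * y1 - g * z1
      + g * contact_covector (x, y, p, w, z) (x1, y1, p1, w1, z1))" for x1 y1 p1 w1 z1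
    using contact_hamiltonian_vfD(2)[OF X q(1)] partial_z_affine_hamiltonian[OF q(2)]
    unfolding X_eq by (simp add: q_eq frechet_derivative_affine_hamiltonian[OF x])
  have 1: "x' $ a = F a x" for a
    using symp[of 0 0 "axis a 1" 0 0] by (simp add: symplectic_def contact_covector_def
        zero A B F inner_axis axis_1_nth if_distrib[of "\<lambda>t. t * _"] cong: if_cong)
  have 2: "y' = - B x"
    using symp[of 0 0 0 1 0] by (simp add: symplectic_def contact_covector_def zero A B F)
  have 3: "p' $ b = frechet_derivative A (at x) (axis b 1) + w * frechet_derivative B (at x) (axis b 1)
        - (\<Sum>a\<in>UNIV. p $ a * frechet_derivative (F a) (at x) (axis b 1)) - g * p $ b" for b
    using symp[of "axis b 1" 0 0 0 0] by (simp add: symplectic_def contact_covector_def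
        inner_axis inner_axis' algebra_simps)
  have 4: "w' = c - g * w"
    using symp[of 0 1 0 0 0] by (simp add: symplectic_def contact_covector_def zero A B F)
  have "z' - p \<bullet> x' - w * y' = affine_hamiltonian A B F c g q"
    using contact_hamiltonian_vfD(1)[OF X q(1)] unfolding X_eq by (simp add: q_eq contact_covector_def)
  then have 5: "z' = A x + c * y - g * z"
    by (simp add: q_eq affine_hamiltonian_def inner_vec_def 1 2)
  show ?thesis
    unfolding X_eq unfolding q_eq affine_contact_field_def
    using 1 2 3 4 5 by (simp add: vec_eq_iff)
qed

lemma affine_contact_field_has_derivative:
  assumes "fst q \<in> T"
  obtains Y' where "(affine_contact_field A B F c g has_derivative Y') (at q)"
    "(\<Sum>b\<in>Basis. Y' b \<bullet> b) = - (real CARD('n) + 2) * g"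
proof -
  let ?D = "\<lambda>f b x. frechet_derivative f (at x) (axis b 1)"
  let ?p = "\<lambda>q :: 'n phase. fst (snd (snd q))" and ?w = "\<lambda>q :: 'n phase. fst (snd (snd (snd q)))"
  let ?d = "\<lambda>f v. frechet_derivative f (at (fst q)) (fst v)"
  have comp: "((\<lambda>q. f (fst q)) has_derivative ?d f) (at q)" if "smooth_on T f" for f
    by (rule has_derivative_comp_fst[OF smooth_on_differentiable[OF that assms]])
  have p: "((\<lambda>q. ?p q $ a) has_derivative (\<lambda>v. ?p v $ a)) (at q)" for a
    by (intro bounded_linear_imp_has_derivative bounded_linear_compose[OF bounded_linear_vec_nth]
        bounded_linear_compose[OF bounded_linear_fst] bounded_linear_compose[OF bounded_linear_snd] bounded_linear_snd)
  have w: "(?w has_derivative ?w) (at q)"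
    by (intro bounded_linear_imp_has_derivative
        bounded_linear_compose[OF bounded_linear_fst] bounded_linear_compose[OF bounded_linear_snd] bounded_linear_snd)
  have yz: "((\<lambda>q :: 'n phase. fst (snd q)) has_derivative (\<lambda>q. fst (snd q))) (at q)"
    "((\<lambda>q :: 'n phase. snd (snd (snd (snd q)))) has_derivative (\<lambda>q. snd (snd (snd (snd q))))) (at q)"
    by (intro bounded_linear_imp_has_derivative
        bounded_linear_compose[OF bounded_linear_fst] bounded_linear_compose[OF bounded_linear_snd] bounded_linear_snd)+
  define Y' where "Y' v = (\<chi> a. ?d (F a) v, - ?d B v,
      \<chi> b. ?d (?D A b) v + (?w q * ?d (?D B b) v + ?w v * ?D B b (fst q))
        - (\<Sum>a\<in>UNIV. ?p q $ a * ?d (?D (F a) b) v + ?p v $ a * ?D (F a) b (fst q)) - g * ?p v $ b,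
      0 - g * ?w v, ?d A v + c * fst (snd v) - g * snd (snd (snd (snd v))))" for v
  have "((\<lambda>q. (\<chi> a. F a (fst q), - B (fst q),
      \<chi> b. ?D A b (fst q) + ?w q * ?D B b (fst q)
        - (\<Sum>a\<in>UNIV. ?p q $ a * ?D (F a) b (fst q)) - g * ?p q $ b,
      c - g * ?w q, A (fst q) + c * fst (snd q) - g * snd (snd (snd (snd q))))) has_derivative Y') (at q)"
    unfolding Y'_def
    by (intro has_derivative_Pair has_derivative_vec_lambda has_derivative_add has_derivative_diff
        has_derivative_minus has_derivative_sum has_derivative_mult has_derivative_mult_right
        has_derivative_const p w yz comp A B F smooth_on_frechet_derivative)
  then have deriv: "(affine_contact_field A B F c g has_derivative Y') (at q)"
    by (simp add: affine_contact_field_def case_prod_unfold)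
  have zero: "frechet_derivative f (at (fst q)) 0 = 0" if "smooth_on T f" for f
    by (rule linear_0[OF linear_frechet_derivative[OF smooth_on_differentiable[OF that assms]]])
  note zeros = zero[OF A] zero[OF B] zero[OF F]
    zero[OF smooth_on_frechet_derivative[OF A]] zero[OF smooth_on_frechet_derivative[OF B]]
    zero[OF smooth_on_frechet_derivative[OF F]]
  \<comment> \<open>The x-block contributes the sum of the dF^a/dx^a and the p-block its negative
    together with -n g; w and z contribute -g each, and y nothing.\<close>
  have "(\<Sum>b\<in>Basis. Y' b \<bullet> b) = - (real CARD('n) + 2) * g"
    by (simp add: sum_Basis_prod sum_Basis_vec Y'_def zeros inner_axis axis_1_nth
        if_distrib[of "\<lambda>t. t * _"] sum_subtractf sum_negf algebra_simps cong: if_cong)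
  with deriv show ?thesis by (rule that)
qed

end

lemma smooth_on_affine_hamiltonian:
  assumes "open S" "smooth_on (fst ` S) A" "smooth_on (fst ` S) B" "\<And>a. smooth_on (fst ` S) (F a)"
  shows "smooth_on S (affine_hamiltonian A B F c g)"
proof -
  have "smooth_on S (\<lambda>q. A (fst q) + fst (snd (snd (snd q))) * B (fst q)
      - (\<Sum>a\<in>UNIV. fst (snd (snd q)) $ a * F a (fst q)) + c * fst (snd q) - g * snd (snd (snd (snd q))))"
    by (intro smooth_on_diff smooth_on_add smooth_on_mult smooth_on_sum smooth_on_const
        smooth_on_comp_fst smooth_on_bounded_linear assms
        bounded_linear_compose[OF bounded_linear_vec_nth]
        bounded_linear_compose[OF bounded_linear_fst] bounded_linear_compose[OF bounded_linear_snd] bounded_linear_snd)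
  then show ?thesis
    by (simp add: affine_hamiltonian_def case_prod_unfold)
qed

section \<open>Invariant densities\<close>

lemma smooth_on_powi_neg:
  assumes "open S" "smooth_on S h" "\<And>q. q \<in> S \<Longrightarrow> h q \<noteq> 0"
  shows "smooth_on S (\<lambda>q. c * h q powi (- int k))"
proof -
  have "smooth_on S (\<lambda>q. c * inverse (h q) ^ k)"
    by (intro smooth_on_mult smooth_on_const smooth_on_power smooth_on_inverse assms)
  then show ?thesis
    by (simp add: power_int_minus power_inverse)
qed

lemma has_derivative_powi_neg:
  fixes h :: "'a::real_normed_vector \<Rightarrow> real"
  assumes "(h has_derivative h') (at q)" "h q \<noteq> 0"
  shows "((\<lambda>q. c * h q powi (- int k)) has_derivative
    (\<lambda>v. c * (- real k * h q powi (- int k - 1) * h' v))) (at q)"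
proof -
  have "((\<lambda>x. x powi (- int k)) has_field_derivative - real k * h q powi (- int k - 1)) (at (h q))"
    using assms(2) by (auto intro!: derivative_eq_intros)
  then have "((\<lambda>x. x powi (- int k)) has_derivative (*) (- real k * h q powi (- int k - 1))) (at (h q))"
    by (simp add: has_field_derivative_def)
  from has_derivative_mult_right[OF has_derivative_compose[OF assms(1) this]] show ?thesis .
qed

text \<open>
  Since \<open>\<gamma>\<^sub>0 \<noteq> 0\<close>, the translates of a point in the direction of \<open>z\<close> meet all nearby levels of the
  Hamiltonian, so that a density \<open>G (h q)\<close> is differentiable in \<open>q\<close> only if \<open>G\<close> is. If moreover
  the density is constant along \<open>X\<close>, then \<open>G\<close> has zero derivative, because \<open>X h\<close> does not vanish.
\<close>

lemma factor_through_levels_deriv_0: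
  fixes h \<phi> :: "'a::real_normed_vector \<Rightarrow> real"
  assumes R: "open R" "q \<in> R" and \<phi>: "\<And>q. q \<in> R \<Longrightarrow> \<phi> q = G (h q)" "\<phi> differentiable (at q)"
    and h: "(h has_derivative h') (at q)"
    and e: "\<And>s. h (q + s *\<^sub>R e) = h q - g * s" "g \<noteq> 0"
    and v: "frechet_derivative \<phi> (at q) v = 0" "h' v \<noteq> 0"
  shows "(G has_real_derivative 0) (at (h q))"
proof -
  \<comment> \<open>A curve through q along e that meets the level s of h exactly at parameter s, so
    that G is the density along this curve.\<close>
  let ?k = "\<lambda>s. q + ((h q - s) / g) *\<^sub>R e"
  have hk: "h (?k s) = s" for s
    using e by simp
  have k: "(?k has_derivative (\<lambda>s. (- s / g) *\<^sub>R e)) (at (h q))"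
    using e(2) by (auto intro!: derivative_eq_intros simp: fun_eq_iff)
  have kq: "?k (h q) = q" by simp
  have \<phi>': "(\<phi> has_derivative frechet_derivative \<phi> (at q)) (at q)"
    by (rule iffD1[OF frechet_derivative_works \<phi>(2)])
  have "((\<lambda>s. \<phi> (?k s)) has_derivative (\<lambda>s. frechet_derivative \<phi> (at q) ((- s / g) *\<^sub>R e))) (at (h q))"
    by (rule has_derivative_compose[OF k, of \<phi>]) (simp add: \<phi>')
  moreover have "continuous (at (h q)) ?k"
    using has_derivative_continuous[OF k] .
  then have "(?k \<longlongrightarrow> q) (at (h q))"
    using kq by (simp add: continuous_at del: right_minus_eq)
  then have "\<forall>\<^sub>F s in at (h q). ?k s \<in> R"
    using R by (rule topological_tendstoD)
  then have ev: "\<forall>\<^sub>F s in at (h q). \<phi> (?k s) = G s"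
    by (rule eventually_mono) (simp only: \<phi>(1) hk)
  ultimately have "(G has_derivative (\<lambda>s. frechet_derivative \<phi> (at q) ((- s / g) *\<^sub>R e))) (at (h q))"
    by (rule has_derivative_transform_eventually) (use R \<phi>(1) in auto)
  moreover from this obtain d where d: "(\<lambda>s. frechet_derivative \<phi> (at q) ((- s / g) *\<^sub>R e)) = (*) d"
    using has_derivative_bounded_linear real_bounded_linear by (metis (no_types, lifting) mult.commute ext)
  ultimately have G: "(G has_derivative (*) d) (at (h q))"
    by simp
  \<comment> \<open>Now that G is differentiable, the chain rule runs the other way: the derivative
    of \<phi> along v is d times that of h, which is nonzero.\<close>
  have "((\<lambda>q. G (h q)) has_derivative (\<lambda>v. d * h' v)) (at q)"
    by (rule has_derivative_compose[OF h G])
  then have "(\<phi> has_derivative (\<lambda>v. d * h' v)) (at q)"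
    by (rule has_derivative_transform_within_open[OF _ R]) (simp add: \<phi>(1))
  then have "d * h' v = 0"
    using frechet_derivative_at v(1) by metis
  then have "d = 0" using v(2) by simp
  with G show ?thesis
    by (simp add: has_field_derivative_def)
qed

theorem theorem5p1:
  fixes C :: "('n::finite) phase set"
    and \<psi> :: "real^'n \<Rightarrow> real"
    and F :: "'n \<Rightarrow> real^'n \<Rightarrow> real"
    and p0 \<gamma>0 :: real
    and X :: "'n phase \<Rightarrow> 'n phase"
    and h :: "'n phase \<Rightarrow> real"
    and R :: "'n phase set"
  assumes "open C"
    and "smooth_on (fst ` C) \<psi>"
    and "\<forall>a. smooth_on (fst ` C) (F a)"
    and "\<forall>a. \<exists>x \<in> fst ` C. F a x \<noteq> 0"
    and "p0 \<noteq> 0"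
    and "\<gamma>0 \<noteq> 0"
    and "h = contact_hamiltonian \<psi> F p0 \<gamma>0"
    and "R = {q \<in> C. h q > 0}"
    and "contact_hamiltonian_vf R h X"
  shows "(\<forall>Z::real. Z \<noteq> 0 \<longrightarrow>
            invariant_measure R X
              (\<lambda>t q vs. 1 / Z * h q powi (- (int CARD('n) + 2)) * standard_volume q vs)) \<and>
         (\<forall>f :: real \<Rightarrow> 'n phase \<Rightarrow> real.
            (\<exists>g. \<forall>t. \<forall>q\<in>R. f t q = g t (h q)) \<and>
            invariant_measure R X (\<lambda>t q vs. f t q * standard_volume q vs) \<longrightarrow>
            (\<forall>K \<in> components C. \<exists>Z::real. Z \<noteq> 0 \<and>
               (\<forall>t. \<forall>q \<in> K \<inter> R. f t q = 1 / Z * h q powi (- (int CARD('n) + 2)))))"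
proof -
  let ?n = "CARD('n)"
  define A where "A = (\<lambda>x. \<gamma>0 * \<psi> x)"
  define B where "B = (\<lambda>x. \<Sum>a\<in>UNIV. frechet_derivative \<psi> (at x) (axis a 1) / p0 * F a x)"
  have h: "h = affine_hamiltonian A B F (\<gamma>0 * p0) \<gamma>0"
    unfolding assms(7) A_def B_def by (rule contact_hamiltonian_affine)
  let ?Y = "affine_contact_field A B F (\<gamma>0 * p0) \<gamma>0"
  let ?T = "fst ` C"
  have T: "open ?T"
    using assms(1) open_image_fst by blast
  have A: "smooth_on ?T A" and F: "smooth_on ?T (F a)" and B: "smooth_on ?T B" for a
    unfolding A_def B_def using assms(2,3)
    by (auto intro!: smooth_on_mult smooth_on_const smooth_on_sum smooth_on_divide_const
        smooth_on_frechet_derivative T)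
  have h_smooth: "smooth_on C h"
    unfolding h by (intro smooth_on_affine_hamiltonian assms(1) A B F)
  have "R = C \<inter> h -` {0<..}"
    using assms(8) by auto
  moreover have "continuous_on C h"
    using h_smooth unfolding smooth_on_def by (metis Ck_on.simps(1))
  ultimately have R: "open R"
    using continuous_on_open_vimage[OF assms(1)] by (metis Int_commute open_greaterThan)
  have RC: "q \<in> C" "fst q \<in> ?T" "h q > 0" if "q \<in> R" for q
    using that assms(8) by auto
  have h_smooth_R: "smooth_on R h"
    using smooth_on_subset[OF _ h_smooth] RC by blast
  have h_deriv: "(h has_derivative frechet_derivative h (at q)) (at q)" if "q \<in> R" for q
    by (rule iffD1[OF frechet_derivative_works smooth_on_differentiable[OF h_smooth_R that]])
  have XY: "X q = ?Y q" if "q \<in> R" for q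
    by (rule affine_contact_field_unique[OF A B F assms(9)[unfolded h] that RC(2)[OF that]])
  \<comment> \<open>X is prescribed on R only; since R is open, agreement with the explicit field
    there transfers the derivative and its trace.\<close>
  have "\<exists>X'. \<forall>q\<in>R. (X has_derivative X' q) (at q) \<and>
      (\<Sum>b\<in>Basis. X' q b \<bullet> b) = - (real ?n + 2) * \<gamma>0"
  proof (rule bchoice, intro ballI)
    fix q assume q: "q \<in> R"
    obtain Y' where Y': "(?Y has_derivative Y') (at q)" "(\<Sum>b\<in>Basis. Y' b \<bullet> b) = - (real ?n + 2) * \<gamma>0"
      by (rule affine_contact_field_has_derivative[OF A B F RC(2)[OF q]])
    have "(X has_derivative Y') (at q)"
      by (rule has_derivative_transform_within_open[OF Y'(1) R q]) (simp add: XY)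
    with Y'(2) show "\<exists>X'. (X has_derivative X') (at q) \<and>
        (\<Sum>b\<in>Basis. X' b \<bullet> b) = - (real ?n + 2) * \<gamma>0"
      by blast
  qed
  then obtain X' where X': "\<forall>q\<in>R. (X has_derivative X' q) (at q)"
    "\<forall>q\<in>R. (\<Sum>b\<in>Basis. X' q b \<bullet> b) = - (real ?n + 2) * \<gamma>0"
    by blast
  define D where "D = standard_volume (0 :: 'n phase)"
  have D: "alternating DIM('n phase) D" "\<exists>vs. D vs \<noteq> 0" "\<And>q. standard_volume q = D"
    unfolding D_def by (rule alternating_standard_volume standard_volume_nonzero standard_volume_constant)+
  note invariant_iff = invariant_measure_density_iff[OF R D(1,2) X']
  have Xh: "frechet_derivative h (at q) (X q) = - \<gamma>0 * h q" if "q \<in> R" for q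
    using contact_hamiltonian_vf_derivative_self[OF assms(9) that]
      partial_z_affine_hamiltonian[OF A B F RC(2)[OF that]]
    by (simp add: h)
  have powi: "- (int ?n + 2) = - int (?n + 2)"
    by simp
  have powi_pred: "x powi (m - 1) * (- \<gamma>0 * x) = - \<gamma>0 * x powi m" if "x \<noteq> 0" for x :: real and m
    using that by (simp add: power_int_diff)
  have invariant: "invariant_measure R X (\<lambda>t q vs. 1 / Z * h q powi (- (int ?n + 2)) * standard_volume q vs)"
    if Z: "Z \<noteq> 0" for Z :: real
    unfolding D(3) powi
  proof (rule iffD2[OF invariant_iff[where f = "\<lambda>t q. 1 / Z * h q powi - int (?n + 2)"]], intro conjI allI ballI)
    show "smooth_on R (\<lambda>q. 1 / Z * h q powi - int (?n + 2))"
      using RC(3) by (intro smooth_on_powi_neg R h_smooth_R) (metis less_irrefl)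
    fix q assume q: "q \<in> R"
    show "1 / Z * h q powi - int (?n + 2) \<noteq> 0"
      using RC(3)[OF q] Z by simp
    have "frechet_derivative (\<lambda>q. 1 / Z * h q powi - int (?n + 2)) (at q) (X q)
        = 1 / Z * (- real (?n + 2) * h q powi (- int (?n + 2) - 1) * (- \<gamma>0 * h q))"
      using frechet_derivative_at[OF has_derivative_powi_neg[OF h_deriv[OF q]], of "1 / Z" "?n + 2"]
        RC(3)[OF q] Xh[OF q] by (metis less_irrefl)
    also have "\<dots> = 1 / Z * (- real (?n + 2) * (h q powi (- int (?n + 2) - 1) * (- \<gamma>0 * h q)))"
      by (simp only: mult.assoc)
    also have "h q powi (- int (?n + 2) - 1) * (- \<gamma>0 * h q) = - \<gamma>0 * h q powi - int (?n + 2)"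
      by (rule powi_pred) (use RC(3)[OF q] in simp)
    finally have deriv: "frechet_derivative (\<lambda>q. 1 / Z * h q powi - int (?n + 2)) (at q) (X q)
        = 1 / Z * (- real (?n + 2) * (- \<gamma>0 * h q powi - int (?n + 2)))" .
    have "1 / Z * (- real (?n + 2) * (- \<gamma>0 * u)) + 1 / Z * u * (- (real ?n + 2) * \<gamma>0) = 0" for u
      using Z by (simp add: field_simps)
    then show "frechet_derivative (\<lambda>q. 1 / Z * h q powi - int (?n + 2)) (at q) (X q)
        + 1 / Z * h q powi - int (?n + 2) * (- (real ?n + 2) * \<gamma>0) = 0"
      unfolding deriv .
  qed simp
  have unique: "\<exists>Z::real. Z \<noteq> 0 \<and> (\<forall>t. \<forall>q\<in>K \<inter> R. f t q = 1 / Z * h q powi (- (int ?n + 2)))"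
    if f: "\<And>t q. q \<in> R \<Longrightarrow> f t q = G t (h q)"
      "invariant_measure R X (\<lambda>t q vs. f t q * standard_volume q vs)" and K: "K \<in> components C"
    for f G K
  proof (cases "K \<inter> R = {}")
    case True
    then show ?thesis by (intro exI[of _ 1]) simp
  next
    case False
    then obtain q0 where q0: "q0 \<in> K" "q0 \<in> R" by blast
    have inv: "\<And>t. smooth_on R (f t)" "\<And>t q. q \<in> R \<Longrightarrow> f t q \<noteq> 0"
        "\<And>t q. q \<in> R \<Longrightarrow> ((\<lambda>s. f s q) has_real_derivative 0) (at t)"
        "\<And>t q. q \<in> R \<Longrightarrow> frechet_derivative (f t) (at q) (X q) + f t q * (- (real ?n + 2) * \<gamma>0) = 0"
      using f(2) unfolding D(3) invariant_iff by blast+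
    \<comment> \<open>This makes one constant serve all times.\<close>
    have time: "f t q = f 0 q" if "q \<in> R" for t q
      using has_field_derivative_zero_constant[of UNIV "\<lambda>s. f s q"] inv(3)[OF that] by force
    let ?N = "?n + 2"
    \<comment> \<open>Not a derivative but the profile divided by the expected power: along X, the
      growth of the density and the decay of h^(n + 2) cancel.\<close>
    define G' where "G' s = G 0 s * s ^ ?N" for s
    have G'0: "(G' has_real_derivative 0) (at (h q))" if q: "q \<in> R" for q
    proof (rule factor_through_levels_deriv_0[OF R q, where e = "(0, 0, 0, 0, 1)" and g = \<gamma>0 and v = "X q"])
      let ?\<phi> = "\<lambda>q. f 0 q * h q ^ ?N"
      show "?\<phi> q = G' (h q)" if "q \<in> R" for q
        using f(1)[OF that] by (simp add: G'_def)
      show "?\<phi> differentiable (at q)"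
        by (rule smooth_on_differentiable[OF smooth_on_mult[OF R inv(1) smooth_on_power[OF R h_smooth_R]] q])
      have f0: "(f 0 has_derivative frechet_derivative (f 0) (at q)) (at q)"
        by (rule iffD1[OF frechet_derivative_works smooth_on_differentiable[OF inv(1) q]])
      have \<phi>': "(?\<phi> has_derivative (\<lambda>v. f 0 q * (of_nat ?N * frechet_derivative h (at q) v * h q ^ (?N - 1))
          + frechet_derivative (f 0) (at q) v * h q ^ ?N)) (at q)"
        by (rule has_derivative_mult[OF f0 has_derivative_power[OF h_deriv[OF q]]])
      have "frechet_derivative (f 0) (at q) (X q) = f 0 q * ((real ?n + 2) * \<gamma>0)"
        using inv(4)[OF q, of 0] by (simp add: algebra_simps)
      then have "f 0 q * (of_nat ?N * frechet_derivative h (at q) (X q) * h q ^ (?N - 1))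
          + frechet_derivative (f 0) (at q) (X q) * h q ^ ?N = 0"
        by (simp add: Xh[OF q] algebra_simps)
      then show "frechet_derivative ?\<phi> (at q) (X q) = 0"
        by (simp only: frechet_derivative_at[OF \<phi>', symmetric])
      show "(h has_derivative frechet_derivative h (at q)) (at q)"
        by (rule h_deriv[OF q])
      show "h (q + s *\<^sub>R (0, 0, 0, 0, 1)) = h q - \<gamma>0 * s" for s
        by (cases q) (simp add: h affine_hamiltonian_def algebra_simps)
      show "frechet_derivative h (at q) (X q) \<noteq> 0"
        using Xh[OF q] assms(6) RC(3)[OF q] by simp
    qed (rule assms(6))
    have "connected (h ` K)"
      using in_components_connected[OF K] in_components_subset[OF K] h_smooth
      by (metis Ck_on.simps(1) connected_continuous_image continuous_on_subset smooth_on_def)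
    then have "is_interval (h ` K \<inter> {0<..})"
      by (intro is_interval_Int) (auto simp: is_interval_connected_1 is_interval_1)
    then have conv: "convex (h ` K \<inter> {0<..})"
      by (rule is_interval_convex)
    \<comment> \<open>Every positive value of h on K is taken at a point of R, where the local
      statement applies. The interval of values need not be open, hence the derivative within
      it.\<close>
    have "(G' has_real_derivative 0) (at s within h ` K \<inter> {0<..})" if s: "s \<in> h ` K \<inter> {0<..}" for s
    proof -
      obtain k where k: "k \<in> K" "s = h k" "0 < h k" using s by blast
      then have "k \<in> R"
        using in_components_subset[OF K] assms(8) by blast
      then show ?thesis
        unfolding k(2) by (rule has_field_derivative_at_within[OF G'0])
    qed
    from has_field_derivative_zero_constant[OF conv this]
    obtain c where c: "\<And>s. s \<in> h ` K \<inter> {0<..} \<Longrightarrow> G' s = c" by blast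
    have fc: "f t q * h q ^ ?N = c" if "q \<in> K \<inter> R" for t q
      using c[of "h q"] that RC(3)[of q] time[of q t] f(1)[of q 0] by (auto simp: G'_def)
    \<comment> \<open>An invariant measure vanishes nowhere, in particular not at \<open>q0\<close>;
      so Z can be taken as the inverse of c.\<close>
    have "c \<noteq> 0"
      using fc[of q0 0] q0 inv(2)[of q0 0] RC(3)[of q0] by auto
    have "f t q = 1 / inverse c * h q powi (- (int ?n + 2))" if "q \<in> K \<inter> R" for t q
    proof -
      have hN: "h q ^ ?N \<noteq> 0"
        using RC(3)[of q] that by simp
      then have "f t q = c * inverse (h q ^ ?N)"
        unfolding fc[OF that, of t, symmetric] by (simp only: mult.assoc right_inverse[OF hN] mult_1_right)
      then show ?thesis
        unfolding powi power_int_minus power_int_of_nat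
        by (simp only: inverse_eq_divide[of "inverse c", symmetric] inverse_inverse_eq)
    qed
    then show ?thesis
      using \<open>c \<noteq> 0\<close> by (intro exI[of _ "inverse c"]) auto
  qed
  show ?thesis
    using invariant unique by blast
qed

end
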